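(* Let $T\in\mathcal{A}_n[\mathbb{R}]$ with symbol $F_T(z,w)$. Then $T\in\mathcal{A}_n(\mathbb{R})$ (i.e. $T$ is real stability preserving) if and only if the polynomial $F_T(z,-w)=F_T(z_1,\ldots,z_n,-w_1,\ldots,-w_n)$ belongs to $\mathcal{H}_{2n}(\mathbb{R})$ (i.e. is real stable as a polynomial in the $2n$ variables $z_1,\ldots,z_n,w_1,\ldots,w_n$).
   Context: A polynomial $f\in\mathbb{C}[z_1,\ldots,z_n]$ is stable if $f(z_1,\ldots,z_n)\neq 0$ whenever $\operatorname{Im}(z_j)>0$ for all $1\le j\le n$; it is real stable if in addition it has real coefficients. $\mathcal{H}_n(\mathbb{R})$ denotes the set of real stable polynomials in $n$ variables. $\mathcal{A}_n[\mathbb{R}]$ is the set of finite order linear differential operators $T=\sum_{\alpha,\beta\in\mathbb{N}^n}a_{\alpha\beta}z^\alpha\partial^\beta$ (finite sum, $\partial_i=\partial/\partial z_i$, multi-index notation) with $a_{\alpha\beta}\in\mathbb{R}$; the symbol of $T$ is $F_T(z,w)=\sum_{\alpha,\beta}a_{\alpha\beta}z^\alpha w^\beta\in\mathbb{R}[z_1,\ldots,z_n,w_1,\ldots,w_n]$. A nonzero operator $T$ is real stability preserving if $T(\mathcal{H}_n(\mathbb{R}))\subseteq\mathcal{H}_n(\mathbb{R})\cup\{0\}$; $\mathcal{A}_n(\mathbb{R})\subset\mathcal{A}_n[\mathbb{R}]$ denotes the set of all real stability preserving operators. *)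

theory Defs
  imports Complex_Main "HOL-Library.Poly_Mapping"
begin

text \<open>
  Polynomials in finitely many commuting variables indexed by a finite type \<open>'v\<close> are finitely
  supported coefficient families on exponent vectors \<open>'v \<Rightarrow>\<^sub>0 nat\<close>; the ring structure is the
  convolution product of \<^theory>\<open>HOL-Library.Poly_Mapping\<close>. With \<open>n = CARD('n)\<close>, the variables
  \<open>z_1, ..., z_n\<close> are indexed by \<open>'n\<close>, and the \<open>2n\<close> variables
  \<open>z_1, ..., z_n, w_1, ..., w_n\<close> by \<open>'n + 'n\<close> (\<open>Inl i\<close> for \<open>z_i\<close>, \<open>Inr i\<close> for \<open>w_i\<close>).
\<close>

type_synonym ('v, 'a) mpoly = "('v \<Rightarrow>\<^sub>0 nat) \<Rightarrow>\<^sub>0 'a"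

definition mconst :: "'a::zero \<Rightarrow> ('v, 'a) mpoly" where
  "mconst c = Poly_Mapping.single 0 c"

definition mvar :: "'v \<Rightarrow> ('v, 'a::zero_neq_one) mpoly" where
  "mvar i = Poly_Mapping.single (Poly_Mapping.single i 1) 1"

text \<open>The power \<open>x\<^sup>\<alpha>\<close> in multi-index notation.\<close>

definition mpow :: "('v::finite \<Rightarrow> 'b::comm_monoid_mult) \<Rightarrow> ('v \<Rightarrow>\<^sub>0 nat) \<Rightarrow> 'b" where
  "mpow x \<alpha> = (\<Prod>i\<in>UNIV. x i ^ Poly_Mapping.lookup \<alpha> i)"

definition meval :: "('v::finite \<Rightarrow> 'a::comm_semiring_1) \<Rightarrow> ('v, 'a) mpoly \<Rightarrow> 'a" where
  "meval x f = (\<Sum>\<alpha>\<in>Poly_Mapping.keys f. Poly_Mapping.lookup f \<alpha> * mpow x \<alpha>)"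

definition msubst ::
  "('v::finite \<Rightarrow> ('u, 'a::comm_semiring_1) mpoly) \<Rightarrow> ('v, 'a) mpoly \<Rightarrow> ('u, 'a) mpoly" where
  "msubst \<sigma> f = (\<Sum>\<alpha>\<in>Poly_Mapping.keys f. mconst (Poly_Mapping.lookup f \<alpha>) * mpow \<sigma> \<alpha>)"

text \<open>
  The partial derivative. The subtraction of exponent vectors is truncated, but this only concerns
  exponents \<open>\<alpha>\<close> with \<open>\<alpha> i = 0\<close>, where the new coefficient is \<open>0\<close>.
\<close>

definition mderiv :: "'v \<Rightarrow> ('v, 'a::comm_semiring_1) mpoly \<Rightarrow> ('v, 'a) mpoly" where
  "mderiv i f = (\<Sum>\<alpha>\<in>Poly_Mapping.keys f.
     Poly_Mapping.single (\<alpha> - Poly_Mapping.single i 1)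
       (of_nat (Poly_Mapping.lookup \<alpha> i) * Poly_Mapping.lookup f \<alpha>))"

lemma lookup_mderiv:
  "Poly_Mapping.lookup (mderiv i f) \<alpha> =
     of_nat (Suc (Poly_Mapping.lookup \<alpha> i)) *
     Poly_Mapping.lookup f (\<alpha> + Poly_Mapping.single i 1)"
proof -
  let ?e = "Poly_Mapping.single i (1::nat)"
  let ?c = "\<lambda>\<beta>. of_nat (Poly_Mapping.lookup \<beta> i) * Poly_Mapping.lookup f \<beta>"
  have *: "(?c \<beta> when \<beta> - ?e = \<alpha>) = (if \<beta> = \<alpha> + ?e then ?c \<beta> else 0)" for \<beta>
  proof (cases "Poly_Mapping.lookup \<beta> i = 0")
    case True
    then have "\<beta> \<noteq> \<alpha> + ?e" by (auto simp: lookup_add)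
    with True show ?thesis by simp
  next
    case False
    have "(\<beta> - ?e = \<alpha>) = (\<beta> = \<alpha> + ?e)"
    proof
      assume "\<beta> - ?e = \<alpha>"
      then have "\<alpha> + ?e = \<beta> - ?e + ?e" by simp
      also have "\<dots> = \<beta>"
        using False by (intro poly_mapping_eqI)
          (auto simp: lookup_add lookup_minus lookup_single when_def)
      finally show "\<beta> = \<alpha> + ?e" by simp
    qed simp
    then show ?thesis by (simp add: when_def)
  qed
  have "Poly_Mapping.lookup (mderiv i f) \<alpha> =
      (\<Sum>\<beta>\<in>Poly_Mapping.keys f. if \<beta> = \<alpha> + ?e then ?c \<beta> else 0)"
    unfolding mderiv_def by (simp only: lookup_sum lookup_single *)
  also have "\<dots> = of_nat (Suc (Poly_Mapping.lookup \<alpha> i)) * Poly_Mapping.lookup f (\<alpha> + ?e)"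
    by (simp only: sum.delta[OF finite_keys]) (simp add: lookup_add in_keys_iff)
  finally show ?thesis .
qed

lemma mderiv_commute: "mderiv i (mderiv j f) = mderiv j (mderiv i f)"
  by (rule poly_mapping_eqI)
    (auto simp: lookup_mderiv lookup_add lookup_single when_def ac_simps)

text \<open>
  The operator \<open>\<partial>\<^sup>\<beta>\<close> composes the powers of the \<open>\<partial>_i\<close> in an arbitrary order, which is
  irrelevant because they commute.
\<close>

definition mderivs :: "('v::finite \<Rightarrow>\<^sub>0 nat) \<Rightarrow> ('v, 'a::comm_semiring_1) mpoly \<Rightarrow> ('v, 'a) mpoly" where
  "mderivs \<beta> f = Finite_Set.fold (\<lambda>i. mderiv i ^^ Poly_Mapping.lookup \<beta> i) f UNIV"

lemma comp_fun_commute_mderiv_funpow: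
  "comp_fun_commute (\<lambda>i. (mderiv i :: ('v, 'a::comm_semiring_1) mpoly \<Rightarrow> _) ^^ k i)"
proof
  fix i j :: 'v
  have 1: "((mderiv j ^^ b) (mderiv i f) :: ('v, 'a) mpoly) = mderiv i ((mderiv j ^^ b) f)" for b f
    by (induction b arbitrary: f) (simp_all add: mderiv_commute)
  have "((mderiv j ^^ b) ((mderiv i ^^ a) f) :: ('v, 'a) mpoly) =
      (mderiv i ^^ a) ((mderiv j ^^ b) f)" for a b f
    by (induction a arbitrary: f) (simp_all add: 1)
  then show "(mderiv j :: ('v, 'a) mpoly \<Rightarrow> _) ^^ k j \<circ> mderiv i ^^ k i =
      mderiv i ^^ k i \<circ> mderiv j ^^ k j"
    by (simp add: fun_eq_iff)
qed

definition stable :: "('v::finite, complex) mpoly \<Rightarrow> bool" where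
  "stable f \<longleftrightarrow> (\<forall>z. (\<forall>j. Im (z j) > 0) \<longrightarrow> meval z f \<noteq> 0)"

definition real_stable :: "('v::finite, complex) mpoly set" where
  "real_stable = {f. stable f \<and> (\<forall>\<alpha>. Poly_Mapping.lookup f \<alpha> \<in> \<real>)}"

text \<open>
  A finitely supported real family \<open>a\<close> on pairs of multi-indices \<open>(\<alpha>, \<beta>)\<close> gives the differential
  operator with coefficients \<open>a\<close>, acting on complex polynomials, and its symbol.
\<close>

definition weyl_op ::
  "(('n::finite \<Rightarrow>\<^sub>0 nat) \<times> ('n \<Rightarrow>\<^sub>0 nat) \<Rightarrow>\<^sub>0 real) \<Rightarrow> ('n, complex) mpoly \<Rightarrow> ('n, complex) mpoly" where
  "weyl_op a f = (\<Sum>(\<alpha>, \<beta>)\<in>Poly_Mapping.keys a.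
     mconst (of_real (Poly_Mapping.lookup a (\<alpha>, \<beta>))) * mpow mvar \<alpha> * mderivs \<beta> f)"

definition weyl_symbol ::
  "(('n::finite \<Rightarrow>\<^sub>0 nat) \<times> ('n \<Rightarrow>\<^sub>0 nat) \<Rightarrow>\<^sub>0 real) \<Rightarrow> ('n + 'n, complex) mpoly" where
  "weyl_symbol a = (\<Sum>(\<alpha>, \<beta>)\<in>Poly_Mapping.keys a.
     mconst (of_real (Poly_Mapping.lookup a (\<alpha>, \<beta>))) *
     mpow (\<lambda>i. mvar (Inl i)) \<alpha> * mpow (\<lambda>i. mvar (Inr i)) \<beta>)"

definition real_weyl_algebra :: "(('n::finite, complex) mpoly \<Rightarrow> ('n, complex) mpoly) set" where
  "real_weyl_algebra = range weyl_op"

definition real_stability_preserving ::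
  "(('n::finite, complex) mpoly \<Rightarrow> ('n, complex) mpoly) set" where
  "real_stability_preserving =
     {T \<in> real_weyl_algebra. T \<noteq> (\<lambda>_. 0) \<and> T ` real_stable \<subseteq> real_stable \<union> {0}}"

text \<open>The substitution \<open>F(z, w) \<mapsto> F(z, -w)\<close>.\<close>

definition negate_w :: "('n::finite + 'n, complex) mpoly \<Rightarrow> ('n + 'n, complex) mpoly" where
  "negate_w = msubst (case_sum (\<lambda>i. mvar (Inl i)) (\<lambda>i. - mvar (Inr i)))"

end

theory Submission
  imports Defs "HOL-Computational_Algebra.Fundamental_Theorem_Algebra" "HOL-Library.FuncSet"
begin

text \<open>
  Write \<open>F(z, w)\<close> for the symbol and \<open>H\<close> for the open upper half-plane.

  If \<open>F(z, -w)\<close> and \<open>f\<close> are stable, then so is \<open>F(z, -w) f(v)\<close>. Each factor \<open>1 - \<partial>\<^sub>v \<partial>\<^sub>w / N\<close>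
  (with \<open>v = v\<^sub>j\<close>, \<open>w = w\<^sub>j\<close>) preserves stability, because a logarithmic derivative of a univariate
  stable polynomial maps \<open>H\<close> to the lower half-plane. Applying it \<open>N\<close> times for every \<open>j\<close>, setting
  \<open>v = z\<close>, \<open>w = \<i> / N\<close> and letting \<open>N\<close> tend to infinity gives \<open>exp(-\<Sum> \<partial>\<^sub>v \<partial>\<^sub>w)\<close> at \<open>w = 0\<close>, which
  replaces \<open>w\<close> by \<open>-\<partial>\<^sub>v\<close>. The limit is \<open>T f\<close>, and Hurwitz' theorem shows that it is stable or zero.

  Conversely, let \<open>T\<close> preserve real stability. For a suitable real \<open>s\<close>, the operator
  \<open>T\<^sub>s = exp(-s z) T exp(s z)\<close> has a part of top degree in \<open>z\<close> that does not vanish on products of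
  univariate polynomials. So \<open>T\<^sub>s h\<close> is zero-free on \<open>H\<^sup>n\<close> whenever \<open>h\<close> is a product of real-rooted
  univariate polynomials. Now add linear factors with roots \<open>\<xi>\<close> in the lower half-plane one at a
  time: \<open>T\<^sub>s ((z\<^sub>j - \<xi>) g) = A - \<xi> B\<close> is zero-free for real \<open>\<xi>\<close>, so \<open>A / B\<close> maps the connected set
  \<open>H\<^sup>n\<close> to nonreal numbers, and its behaviour at infinity shows that it maps into \<open>H\<close>. Applying this
  to \<open>\<Prod> (1 - z\<^sub>j w\<^sub>j / N)\<^sup>N\<close>, which approximates \<open>exp(-z w)\<close>, yields that \<open>F(z, s - w)\<close> is stable.
\<close>

subsection \<open>Zeros of univariate polynomials and Hurwitz' theorem\<close>

lemma linear_factor_obtain: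
  fixes p :: "complex poly"
  assumes "degree p = Suc d"
  obtains \<xi> q where "p = [:-\<xi>, 1:] * q" "degree q = d"
proof -
  have "\<not> constant (poly p)"
    using assms by (simp add: constant_degree)
  then obtain \<xi> where "poly p \<xi> = 0"
    using fundamental_theorem_of_algebra by blast
  then obtain q where q: "p = [:-\<xi>, 1:] * q"
    by (auto simp: poly_eq_0_iff_dvd)
  with assms have "q \<noteq> 0" by auto
  then have "degree q = d"
    using assms unfolding q by (subst (asm) degree_mult_eq) auto
  with q that show ?thesis by blast
qed

text \<open>Every root \<open>\<xi>\<close> satisfies |\<open>\<xi>\<close>| >= \<open>r\<close>,
  hence |\<open>t\<close> - \<open>\<xi>\<close>| <= 2 |\<open>\<xi>\<close>|; splitting off the
  roots one at a time multiplies these estimates. The constant depends only on the degree, so the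
  bound survives a limit of polynomials of bounded degree.\<close>

lemma norm_poly_le_zero_free_ball:
  fixes p :: "complex poly"
  assumes "\<And>t. norm t < r \<Longrightarrow> poly p t \<noteq> 0" "norm t < r"
  shows "norm (poly p t) \<le> 2 ^ degree p * norm (poly p 0)"
  using assms
proof (induction "degree p" arbitrary: p)
  case 0
  then obtain c where "p = [:c:]" by (metis degree_eq_zeroE)
  then show ?case by simp
next
  case (Suc d)
  obtain \<xi> q where q: "p = [:-\<xi>, 1:] * q" "degree q = d"
    using linear_factor_obtain Suc(2) by metis
  have nz: "poly q u \<noteq> 0" "u \<noteq> \<xi>" if "norm u < r" for u
    using Suc(3)[OF that] unfolding q by auto
  have "norm \<xi> \<ge> r" using nz(2)[of \<xi>] by force
  then have "norm (t - \<xi>) \<le> 2 * norm \<xi>"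
    using norm_triangle_ineq4[of t \<xi>] Suc(4) by simp
  moreover have "norm (poly q t) \<le> 2 ^ d * norm (poly q 0)"
    using Suc(1)[of q] q(2) nz Suc(4) by blast
  ultimately have "norm (t - \<xi>) * norm (poly q t) \<le> (2 * norm \<xi>) * (2 ^ d * norm (poly q 0))"
    by (intro mult_mono) auto
  moreover have "norm (poly p t) = norm (t - \<xi>) * norm (poly q t)"
    unfolding q by (simp add: algebra_simps flip: norm_mult)
  moreover have "norm (poly p 0) = norm \<xi> * norm (poly q 0)"
    unfolding q by (simp add: norm_mult)
  ultimately show ?case
    unfolding Suc(2)[symmetric] by (simp add: algebra_simps)
qed

text \<open>The logarithmic derivative is the sum of 1 / (x - \<open>\<xi>\<close>) over the roots.
  Since Im \<open>\<xi>\<close> <= 0 < Im x, every summand has negative imaginary part, and there is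
  at least one summand as soon as the degree is positive.\<close>

lemma Im_log_deriv_le_0:
  fixes p :: "complex poly"
  assumes "\<And>x. Im x > 0 \<Longrightarrow> poly p x \<noteq> 0" "Im x > 0"
  shows "Im (poly (pderiv p) x / poly p x) \<le> 0 \<and>
    (degree p > 0 \<longrightarrow> Im (poly (pderiv p) x / poly p x) < 0)"
  using assms
proof (induction "degree p" arbitrary: p)
  case 0
  then obtain c where "p = [:c:]" by (metis degree_eq_zeroE)
  then show ?case by simp
next
  case (Suc d)
  obtain \<xi> q where q: "p = [:-\<xi>, 1:] * q" "degree q = d"
    using linear_factor_obtain Suc(2) by metis
  have nz: "poly q u \<noteq> 0" "u \<noteq> \<xi>" if "Im u > 0" for u
    using Suc(3)[OF that] unfolding q by auto
  have \<xi>: "Im \<xi> \<le> 0" using nz(2)[of \<xi>] by force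
  have x: "poly q x \<noteq> 0" "x \<noteq> \<xi>" using nz Suc(4) by blast+
  have "poly (pderiv p) x / poly p x = 1 / (x - \<xi>) + poly (pderiv q) x / poly q x"
  proof -
    have "poly (pderiv p) x = poly q x + (x - \<xi>) * poly (pderiv q) x"
      unfolding q pderiv_mult by (simp add: pderiv_pCons algebra_simps)
    moreover have "poly p x = (x - \<xi>) * poly q x"
      unfolding q by (simp add: algebra_simps)
    ultimately show ?thesis using x by (simp add: divide_simps)
  qed
  moreover have "Im (poly (pderiv q) x / poly q x) \<le> 0"
    using Suc(1)[of q] q(2) nz Suc(4) by blast
  moreover have "Im (1 / (x - \<xi>)) < 0"
  proof -
    have "Im (1 / (x - \<xi>)) = - (Im x - Im \<xi>) / (norm (x - \<xi>))\<^sup>2"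
      by (simp add: Im_divide cmod_power2)
    also have "\<dots> < 0" using \<xi> Suc(4) x by (intro divide_neg_pos) auto
    finally show ?thesis .
  qed
  ultimately show ?case by simp
qed

section \<open>Families of bounded degree on complex lines\<close>

definition upper :: "('v \<Rightarrow> complex) set" where
  "upper = {z. \<forall>j. Im (z j) > 0}"

text \<open>Describes polynomial functions without reference to coefficients. One \<open>d\<close>
  bounds the degree for all \<open>N\<close> and all complex lines; this uniformity is what the
  limit argument for Hurwitz' theorem rests on.\<close>

definition poly_seq :: "(nat \<Rightarrow> ('v \<Rightarrow> complex) \<Rightarrow> complex) \<Rightarrow> bool" where
  "poly_seq F \<longleftrightarrow> (\<exists>d. \<forall>N z l. \<exists>p. degree p \<le> d \<and> (\<forall>t. F N (\<lambda>i. z i + t * l i) = poly p t))"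

lemma poly_seq_const [intro]: "poly_seq (\<lambda>N z. c N)"
  unfolding poly_seq_def by (rule exI[of _ 0], intro allI, rule_tac x="[:c N:]" in exI) auto

lemma poly_seq_coord [intro]: "poly_seq (\<lambda>N z. z j)"
  unfolding poly_seq_def by (rule exI[of _ 1], intro allI, rule_tac x="[:z j, l j:]" in exI) auto

lemma poly_seq_add [intro]:
  assumes "poly_seq F" "poly_seq G"
  shows "poly_seq (\<lambda>N z. F N z + G N z)"
proof -
  obtain d where d: "\<And>N z l. \<exists>p. degree p \<le> d \<and> (\<forall>t. F N (\<lambda>i. z i + t * l i) = poly p t)"
    using assms(1) unfolding poly_seq_def by blast
  obtain e where e: "\<And>N z l. \<exists>p. degree p \<le> e \<and> (\<forall>t. G N (\<lambda>i. z i + t * l i) = poly p t)"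
    using assms(2) unfolding poly_seq_def by blast
  show ?thesis
    unfolding poly_seq_def
  proof (rule exI[of _ "max d e"], intro allI)
    fix N and z l :: "'a \<Rightarrow> complex"
    obtain p where p: "degree p \<le> d" "\<And>t. F N (\<lambda>i. z i + t * l i) = poly p t" using d by blast
    obtain q where q: "degree q \<le> e" "\<And>t. G N (\<lambda>i. z i + t * l i) = poly q t" using e by blast
    show "\<exists>p. degree p \<le> max d e \<and>
        (\<forall>t. F N (\<lambda>i. z i + t * l i) + G N (\<lambda>i. z i + t * l i) = poly p t)"
      using p q by (intro exI[of _ "p + q"]) (auto intro!: degree_add_le)
  qed
qed

lemma poly_seq_mult [intro]:
  assumes "poly_seq F" "poly_seq G"
  shows "poly_seq (\<lambda>N z. F N z * G N z)"
proof -
  obtain d where d: "\<And>N z l. \<exists>p. degree p \<le> d \<and> (\<forall>t. F N (\<lambda>i. z i + t * l i) = poly p t)"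
    using assms(1) unfolding poly_seq_def by blast
  obtain e where e: "\<And>N z l. \<exists>p. degree p \<le> e \<and> (\<forall>t. G N (\<lambda>i. z i + t * l i) = poly p t)"
    using assms(2) unfolding poly_seq_def by blast
  show ?thesis
    unfolding poly_seq_def
  proof (rule exI[of _ "d + e"], intro allI)
    fix N and z l :: "'a \<Rightarrow> complex"
    obtain p where p: "degree p \<le> d" "\<And>t. F N (\<lambda>i. z i + t * l i) = poly p t" using d by blast
    obtain q where q: "degree q \<le> e" "\<And>t. G N (\<lambda>i. z i + t * l i) = poly q t" using e by blast
    show "\<exists>p. degree p \<le> d + e \<and>
        (\<forall>t. F N (\<lambda>i. z i + t * l i) * G N (\<lambda>i. z i + t * l i) = poly p t)"
      using p q by (intro exI[of _ "p * q"]) (auto intro: order.trans[OF degree_mult_le])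
  qed
qed

lemma poly_seq_power [intro]: "poly_seq F \<Longrightarrow> poly_seq (\<lambda>N z. F N z ^ k)"
  by (induction k) auto

lemma poly_seq_sum [intro]:
  "(\<And>i. i \<in> I \<Longrightarrow> poly_seq (F i)) \<Longrightarrow> poly_seq (\<lambda>N z. \<Sum>i\<in>I. F i N z)"
  by (induction I rule: infinite_finite_induct) auto

lemma poly_seq_prod [intro]:
  "(\<And>i. i \<in> I \<Longrightarrow> poly_seq (F i)) \<Longrightarrow> poly_seq (\<lambda>N z. \<Prod>i\<in>I. F i N z)"
  by (induction I rule: infinite_finite_induct) auto

lemma poly_seq_poly [intro]: "poly_seq F \<Longrightarrow> poly_seq (\<lambda>N z. poly p (F N z))"
  by (induction p) auto

lemma poly_seq_mpow [intro]: "poly_seq (\<lambda>N z. mpow z \<alpha>)"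
  unfolding mpow_def by (intro poly_seq_prod poly_seq_power poly_seq_coord)

text \<open>On the complex line through \<open>z0\<close> and \<open>z1\<close>, a small disc around
  \<open>z0\<close> stays in \<open>upper\<close>. There \<open>norm_poly_le_zero_free_ball\<close>
  bounds \<open>F N\<close> by \<open>2 ^ d\<close> times its value at \<open>z0\<close>, which
  tends to 0. So the limit vanishes on the disc, hence on the whole line, including
  \<open>z1\<close>, which may lie outside \<open>upper\<close>.\<close>

lemma Hurwitz_upper:
  fixes F :: "nat \<Rightarrow> ('v::finite \<Rightarrow> complex) \<Rightarrow> complex"
  assumes F: "poly_seq F" and f: "poly_seq (\<lambda>_. f)"
    and nz: "\<forall>\<^sub>F N in sequentially. \<forall>z\<in>upper. F N z \<noteq> 0"
    and lim: "\<And>z. z \<in> upper \<Longrightarrow> (\<lambda>N. F N z) \<longlonglongrightarrow> f z"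
    and zero: "z0 \<in> upper" "f z0 = 0"
  shows "f z1 = 0"
proof -
  define L where "L t = (\<lambda>i. z0 i + t * (z1 i - z0 i))" for t
  obtain d where d: "\<And>N z l. \<exists>p. degree p \<le> d \<and> (\<forall>t. F N (\<lambda>i. z i + t * l i) = poly p t)"
    using F unfolding poly_seq_def by blast
  obtain q where q: "\<And>t. f (L t) = poly q t"
    using f unfolding poly_seq_def L_def by metis
  have "\<forall>i. \<exists>r>0. \<forall>t. norm t < r \<longrightarrow> Im (L t i) > 0"
  proof
    fix i
    have z0: "Im (z0 i) > 0" using zero(1) by (auto simp: upper_def)
    have "((\<lambda>t. Im (L t i)) \<longlongrightarrow> Im (z0 i + 0 * (z1 i - z0 i))) (nhds 0)"
      unfolding L_def by (intro tendsto_intros filterlim_ident)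
    then have "((\<lambda>t. Im (L t i)) \<longlongrightarrow> Im (z0 i)) (nhds 0)" by simp
    from order_tendstoD(1)[OF this z0]
    show "\<exists>r>0. \<forall>t. norm t < r \<longrightarrow> Im (L t i) > 0"
      by (simp add: eventually_nhds_metric)
  qed
  then obtain r where r: "\<And>i. r i > 0" "\<And>i t. norm t < r i \<Longrightarrow> Im (L t i) > 0" by metis
  define R where "R = Min (range r)"
  have R: "R > 0" using r by (simp add: R_def)
  have up: "L t \<in> upper" if "norm t < R" for t
  proof -
    have "Im (L t i) > 0" for i
    proof (rule r(2))
      have "R \<le> r i" by (simp add: R_def)
      with that show "norm t < r i" by simp
    qed
    then show ?thesis by (simp add: upper_def)
  qed
  have L0: "L 0 = z0" by (simp add: L_def)
  have "poly q t = 0" if t: "norm t < R" for t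
  proof -
    have "\<forall>\<^sub>F N in sequentially. norm (F N (L t)) \<le> 2 ^ d * norm (F N z0)"
      using nz
    proof eventually_elim
      case (elim N)
      obtain p where p: "degree p \<le> d" "\<And>t. F N (L t) = poly p t" using d unfolding L_def by metis
      have "norm (poly p t) \<le> 2 ^ degree p * norm (poly p 0)"
        using elim up t p(2) by (intro norm_poly_le_zero_free_ball[of R]) metis+
      also have "\<dots> \<le> 2 ^ d * norm (poly p 0)"
        using p(1) by (intro mult_right_mono power_increasing) auto
      finally show ?case using p(2)[of t] p(2)[of 0] by (simp add: L0)
    qed
    moreover have "(\<lambda>N. norm (F N (L t))) \<longlonglongrightarrow> norm (f (L t))"
      by (intro tendsto_norm lim up t)
    moreover have "(\<lambda>N. 2 ^ d * norm (F N z0)) \<longlonglongrightarrow> 2 ^ d * norm (f z0)"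
      by (intro tendsto_intros lim zero)
    ultimately have "norm (f (L t)) \<le> 2 ^ d * norm (f z0)"
      by (intro tendsto_le[OF sequentially_bot])
    then show ?thesis using zero q by simp
  qed
  then have "{t. norm t < R} \<subseteq> {t. poly q t = 0}" by auto
  moreover have "infinite ({t::complex. norm t < R})"
  proof
    assume fin: "finite ({t::complex. norm t < R})"
    have "inj (\<lambda>n. of_real (R / (of_nat n + 2)) :: complex)"
      using R by (auto simp: inj_on_def field_simps)
    then have "infinite (range (\<lambda>n. of_real (R / (of_nat n + 2)) :: complex))"
      using finite_imageD by blast
    moreover have "range (\<lambda>n. of_real (R / (of_nat n + 2)) :: complex) \<subseteq> {t. norm t < R}"
      using R by (auto simp: norm_divide field_simps intro!: add_pos_nonneg simp flip: of_real_add)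
    ultimately show False using fin finite_subset by blast
  qed
  ultimately have "q = 0" using poly_roots_finite finite_subset by blast
  with q[of 1] show ?thesis by (simp add: L_def)
qed

subsection \<open>The operators \<open>1 - \<epsilon> \<partial>\<^sub>x \<partial>\<^sub>y\<close>\<close>

text \<open>If \<open>g\<close> is not zero, it has no zeros in the upper half-plane, by Hurwitz. A
  zero at \<open>x\<close> would give g'/g = f/(e g) there. The right side has imaginary part >= 0,
  because g/f lies in the closed lower half-plane, while the left side has negative imaginary part
  unless \<open>g\<close> is constant; a constant \<open>g\<close> would force f = 0.\<close>

lemma nonvanishing_minus_pderiv:
  fixes f g :: "complex poly"
  assumes f: "\<And>x. Im x > 0 \<Longrightarrow> poly f x \<noteq> 0"
    and fg: "\<And>x. Im x > 0 \<Longrightarrow> Im (poly g x / poly f x) \<le> 0"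
    and e: "e > 0" and x: "Im x > 0"
  shows "poly f x - of_real e * poly (pderiv g) x \<noteq> 0"
proof (cases "g = 0")
  case True
  then show ?thesis using f x by simp
next
  case False
  \<comment> \<open>A zero of \<open>F N\<close> would mean g/f = i/(N+1), which is excluded by the
    sign of the imaginary part. The index type \<open>unit\<close> turns the multivariate Hurwitz
    lemma into a univariate one.\<close>
  define F where "F = (\<lambda>N (z :: unit \<Rightarrow> complex). poly g (z ()) + (- \<i> / of_nat (Suc N)) * poly f (z ()))"
  have g: "poly g y \<noteq> 0" if y: "Im y > 0" for y
  proof
    assume 0: "poly g y = 0"
    have "poly g y' = 0" for y'
    proof -
      have F: "poly_seq F"
        unfolding F_def by (intro poly_seq_add poly_seq_mult poly_seq_poly poly_seq_coord poly_seq_const)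
      have lim: "(\<lambda>N. F N z) \<longlonglongrightarrow> poly g (z ())" for z
      proof -
        have "(\<lambda>N. F N z) \<longlonglongrightarrow> poly g (z ()) + 0 * poly f (z ())"
          unfolding F_def
        proof (intro tendsto_intros)
          have "(\<lambda>N. - \<i> * inverse (of_nat (Suc N) :: complex)) \<longlonglongrightarrow> - \<i> * 0"
            by (intro tendsto_intros LIMSEQ_Suc[OF lim_inverse_n])
          then show "(\<lambda>N. - \<i> / (of_nat (Suc N) :: complex)) \<longlonglongrightarrow> 0"
            by (simp add: divide_inverse)
        qed
        then show ?thesis by simp
      qed
      have nz: "F N z \<noteq> 0" if "z \<in> upper" for N z
      proof
        have z: "Im (z ()) > 0" using that by (simp add: upper_def)
        assume "F N z = 0"
        then have "poly g (z ()) / poly f (z ()) = \<i> / of_nat (Suc N)"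
          using f[OF z] unfolding F_def by (simp add: field_simps del: of_nat_Suc)
        moreover have "Im (\<i> / of_nat (Suc N)) > 0"
          by (simp add: Im_divide_of_nat del: of_nat_Suc)
        ultimately show False using fg[OF z] by simp
      qed
      have "poly g ((\<lambda>_::unit. y') ()) = 0"
        by (rule Hurwitz_upper[of F "\<lambda>z. poly g (z ())" "\<lambda>_. y"])
          (use F lim nz y 0 in \<open>auto simp: upper_def intro!: poly_seq_poly poly_seq_coord\<close>)
      then show ?thesis .
    qed
    with False show False by (auto simp: poly_eq_poly_eq_iff[symmetric] fun_eq_iff)
  qed
  show ?thesis
  proof
    assume "poly f x - of_real e * poly (pderiv g) x = 0"
    then have eq: "poly (pderiv g) x / poly g x = of_real (1 / e) * (poly f x / poly g x)"
      using e by (simp add: field_simps)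
    have "Im (poly f x / poly g x) \<ge> 0"
      using fg[OF x] f[OF x] unfolding Im_divide complex_neq_0 by (simp add: divide_le_0_iff zero_le_divide_iff algebra_simps
          add_nonneg_eq_0_iff not_le sum_power2_gt_zero_iff)
    then have "Im (poly (pderiv g) x / poly g x) \<ge> 0"
      unfolding eq using e by (simp only: Im_complex_of_real Re_complex_of_real times_complex.sel) simp
    then have "degree g = 0" using Im_log_deriv_le_0[of g x] g x by force
    then have "pderiv g = 0" by (simp add: pderiv_eq_0_iff)
    with eq g[OF x] f[OF x] e show False by simp
  qed
qed

text \<open>A list of pairs \<open>(p, q)\<close> stands for the bivariate polynomial \<open>\<Sum> p(x) q(y)\<close>.\<close>

definition biv :: "(complex poly \<times> complex poly) list \<Rightarrow> complex \<Rightarrow> complex \<Rightarrow> complex" where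
  "biv L x y = (\<Sum>(p, q)\<leftarrow>L. poly p x * poly q y)"

text \<open>For fixed \<open>y\<close>, let f be the polynomial in its first variable and g its
  derivative in the second. At each u the quotient g/f is a logarithmic derivative in the second
  variable, so its imaginary part is <= 0 and \<open>nonvanishing_minus_pderiv\<close> applies. The
  appended list carries the mixed derivative.\<close>

lemma biv_minus_mixed_deriv:
  assumes nz: "\<And>x y. Im x > 0 \<Longrightarrow> Im y > 0 \<Longrightarrow> biv L x y \<noteq> 0"
    and e: "e > 0" and "Im x > 0" "Im y > 0"
  shows "biv (L @ map (\<lambda>(p, q). (smult (- of_real e) (pderiv p), pderiv q)) L) x y \<noteq> 0"
proof -
  define f where "f = (\<Sum>(p, q)\<leftarrow>L. smult (poly q y) p)"
  define g where "g = (\<Sum>(p, q)\<leftarrow>L. smult (poly (pderiv q) y) p)"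
  define h where "h u = (\<Sum>(p, q)\<leftarrow>L. smult (poly p u) q)" for u
  have f: "poly f u = biv L u y" for u
    unfolding f_def biv_def by (induction L) (auto simp: algebra_simps)
  have h: "poly (h u) v = biv L u v" for u v
    unfolding h_def biv_def by (induction L) (auto simp: algebra_simps)
  have g: "poly g u = poly (pderiv (h u)) y" for u
    unfolding g_def h_def by (induction L) (auto simp: pderiv_add pderiv_smult algebra_simps)
  have "poly f x - of_real e * poly (pderiv g) x \<noteq> 0"
  proof (rule nonvanishing_minus_pderiv)
    fix u assume u: "Im u > 0"
    show "poly f u \<noteq> 0" using nz u assms(4) by (simp add: f)
    show "Im (poly g u / poly f u) \<le> 0"
      using Im_log_deriv_le_0[of "h u" y] nz u assms(4) by (simp add: f g h)
  qed fact+
  moreover have "of_real e * poly (pderiv g) x =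
      - (\<Sum>(p, q)\<leftarrow>L. poly (smult (- of_real e) (pderiv p)) x * poly (pderiv q) y)"
    unfolding g_def by (induction L) (auto simp: pderiv_add pderiv_smult algebra_simps)
  ultimately show ?thesis
    by (simp add: biv_def f o_def case_prod_unfold)
qed

text \<open>Pascal's rule in summed form. It is the induction step both for powers of the mixed
  derivative operator and for the Leibniz rule.\<close>

lemma sum_choose_Suc:
  "(\<Sum>k\<le>Suc n. of_nat (Suc n choose k) * f k) =
   (\<Sum>k\<le>n. of_nat (n choose k) * (f k + f (Suc k) :: 'a::comm_semiring_1))"
proof -
  have "(\<Sum>k\<le>Suc n. of_nat (Suc n choose k) * f k) =
      f 0 + (\<Sum>k\<le>n. of_nat (n choose Suc k) * f (Suc k)) + (\<Sum>k\<le>n. of_nat (n choose k) * f (Suc k))"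
    by (subst sum.atMost_Suc_shift) (simp add: sum.distrib algebra_simps)
  also have "f 0 + (\<Sum>k\<le>n. of_nat (n choose Suc k) * f (Suc k)) = (\<Sum>k\<le>Suc n. of_nat (n choose k) * f k)"
    by (subst sum.atMost_Suc_shift) simp
  also have "(\<Sum>k\<le>Suc n. of_nat (n choose k) * f k) = (\<Sum>k\<le>n. of_nat (n choose k) * f k)"
    by (simp add: binomial_eq_0)
  finally show ?thesis by (simp only: sum.distrib distrib_left)
qed

text \<open>The value of \<open>(1 - \<epsilon> \<partial>\<^sub>x \<partial>\<^sub>y)\<^sup>N\<close> applied to \<open>p(x) q(y)\<close>.\<close>

definition heat :: "complex \<Rightarrow> nat \<Rightarrow> complex poly \<Rightarrow> complex poly \<Rightarrow> complex \<Rightarrow> complex \<Rightarrow> complex" where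
  "heat e N p q x y =
     (\<Sum>k\<le>N. of_nat (N choose k) * ((- e) ^ k * poly ((pderiv ^^ k) p) x * poly ((pderiv ^^ k) q) y))"

lemma heat_Suc: "heat e (Suc N) p q x y = heat e N p q x y + heat e N (smult (- e) (pderiv p)) (pderiv q) x y"
  unfolding heat_def sum_choose_Suc sum.distrib[symmetric]
  by (intro sum.cong refl)
    (simp add: higher_pderiv_smult funpow_swap1 algebra_simps del: smult_minus_left)

text \<open>The list is generalised in the induction: one factor of the operator is applied first,
  by passing to the longer list, and the remaining \<open>N\<close> factors act on that
  list.\<close>

lemma heat_nonzero:
  assumes "\<And>x y. Im x > 0 \<Longrightarrow> Im y > 0 \<Longrightarrow> biv L x y \<noteq> 0" "e > 0" "Im x > 0" "Im y > 0"
  shows "(\<Sum>(p, q)\<leftarrow>L. heat (of_real e) N p q x y) \<noteq> 0"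
  using assms
proof (induction N arbitrary: L)
  case 0
  then show ?case by (simp add: heat_def biv_def)
next
  case (Suc N)
  let ?L = "map (\<lambda>(p, q). (smult (- of_real e) (pderiv p), pderiv q)) L"
  have "(\<Sum>(p, q)\<leftarrow>L @ ?L. heat (of_real e) N p q x y) \<noteq> 0"
    by (rule Suc(1)) (use Suc(2-) biv_minus_mixed_deriv in \<open>auto\<close>)
  also have "(\<Sum>(p, q)\<leftarrow>L @ ?L. heat (of_real e) N p q x y) = (\<Sum>(p, q)\<leftarrow>L. heat (of_real e) (Suc N) p q x y)"
    by (simp add: heat_Suc o_def case_prod_unfold sum_list_addf)
  finally show ?case .
qed

text \<open>Induction on the set \<open>K\<close> of variables already treated. For a further
  variable \<open>k\<close>, all other coordinates are frozen, which leaves a bivariate polynomial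
  in coordinate \<open>k\<close> of \<open>v\<close> and \<open>w\<close>, and
  \<open>heat_nonzero\<close> applies to it.\<close>

lemma heat_monom_nonzero:
  fixes b c :: "'i \<Rightarrow> 'n::finite \<Rightarrow> nat"
  assumes I: "finite I" and e: "e > 0" and K: "finite K"
    and nz: "\<And>v w. v \<in> upper \<Longrightarrow> w \<in> upper \<Longrightarrow>
      (\<Sum>i\<in>I. a i * (\<Prod>j\<in>UNIV. v j ^ b i j * w j ^ c i j)) \<noteq> 0"
    and vw: "v \<in> upper" "w \<in> upper"
  shows "(\<Sum>i\<in>I. a i * (\<Prod>j\<in>UNIV. if j \<in> K
      then heat (of_real e) N (monom 1 (b i j)) (monom 1 (c i j)) (v j) (w j)
      else v j ^ b i j * w j ^ c i j)) \<noteq> 0"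
  using K vw
proof (induction K arbitrary: v w rule: finite_induct)
  case empty
  then show ?case using nz by simp
next
  case (insert k K)
  define R where "R i v w = (\<Prod>j\<in>UNIV-{k}. if j \<in> K
      then heat (of_real e) N (monom 1 (b i j)) (monom 1 (c i j)) (v j) (w j)
      else v j ^ b i j * w j ^ c i j)" for i v w
  \<comment> \<open>The factors from all variables other than \<open>k\<close> are constants now and
    become coefficients.\<close>
  define r where "r i = a i * R i v w" for i
  obtain xs where xs: "set xs = I" "distinct xs" using I finite_distinct_list by blast
  define L :: "(complex poly \<times> complex poly) list" where "L = map (\<lambda>i. (smult (r i) (monom 1 (b i k)), monom 1 (c i k))) xs"
  have "biv L x y \<noteq> 0" if "Im x > 0" "Im y > 0" for x y
  proof -
    have "(\<Sum>i\<in>I. a i * (\<Prod>j\<in>UNIV. if j \<in> K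
        then heat (of_real e) N (monom 1 (b i j)) (monom 1 (c i j)) ((v(k:=x)) j) ((w(k:=y)) j)
        else (v(k:=x)) j ^ b i j * (w(k:=y)) j ^ c i j)) \<noteq> 0"
      by (rule insert.IH) (use insert.prems that in \<open>auto simp: upper_def\<close>)
    also have "(\<lambda>i. (\<Prod>j\<in>UNIV. if j \<in> K
        then heat (of_real e) N (monom 1 (b i j)) (monom 1 (c i j)) ((v(k:=x)) j) ((w(k:=y)) j)
        else (v(k:=x)) j ^ b i j * (w(k:=y)) j ^ c i j)) =
        (\<lambda>i. R i v w * (x ^ b i k * y ^ c i k))"
    proof
      fix i
      have "R i (v(k:=x)) (w(k:=y)) = R i v w"
        unfolding R_def by (rule prod.cong) auto
      then show "(\<Prod>j\<in>UNIV. if j \<in> K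
        then heat (of_real e) N (monom 1 (b i j)) (monom 1 (c i j)) ((v(k:=x)) j) ((w(k:=y)) j)
        else (v(k:=x)) j ^ b i j * (w(k:=y)) j ^ c i j) = R i v w * (x ^ b i k * y ^ c i k)"
        using insert.hyps by (subst prod.remove[of _ k]) (auto simp: R_def)
    qed
    also have "(\<Sum>i\<in>I. a i * (R i v w * (x ^ b i k * y ^ c i k))) = biv L x y"
      unfolding biv_def L_def
      by (simp add: o_def sum_list_distinct_conv_sum_set xs poly_monom r_def mult_ac)
    finally show ?thesis .
  qed
  from heat_nonzero[OF this e]
  have "(\<Sum>(p, q)\<leftarrow>L. heat (of_real e) N p q (v k) (w k)) \<noteq> 0"
    using insert.prems by (simp add: upper_def)
  also have "(\<Sum>(p, q)\<leftarrow>L. heat (of_real e) N p q (v k) (w k)) =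
      (\<Sum>i\<in>I. r i * heat (of_real e) N (monom 1 (b i k)) (monom 1 (c i k)) (v k) (w k))"
    unfolding L_def
    by (simp add: o_def sum_list_distinct_conv_sum_set xs heat_def higher_pderiv_smult sum_distrib_left mult_ac)
  also have "\<dots> = (\<Sum>i\<in>I. a i * (\<Prod>j\<in>UNIV. if j \<in> insert k K
      then heat (of_real e) N (monom 1 (b i j)) (monom 1 (c i j)) (v j) (w j)
      else v j ^ b i j * w j ^ c i j))"
  proof (rule sum.cong[OF refl])
    fix i
    have "R i v w = (\<Prod>j\<in>UNIV-{k}. if j \<in> insert k K
      then heat (of_real e) N (monom 1 (b i j)) (monom 1 (c i j)) (v j) (w j)
      else v j ^ b i j * w j ^ c i j)"
      unfolding R_def by (rule prod.cong) auto
    then show "r i * heat (of_real e) N (monom 1 (b i k)) (monom 1 (c i k)) (v k) (w k) =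
        a i * (\<Prod>j\<in>UNIV. if j \<in> insert k K
          then heat (of_real e) N (monom 1 (b i j)) (monom 1 (c i j)) (v j) (w j)
          else v j ^ b i j * w j ^ c i j)"
      by (subst prod.remove[of _ k]) (auto simp: r_def mult_ac)
  qed
  finally show ?case .
qed

section \<open>The limit of the iterated operators\<close>

lemma fact_choose_Suc: "fact (Suc k) * (N choose Suc k) = (N - k) * (fact k * (N choose k))"
proof -
  have "Suc k * (N choose Suc k) = (N - k) * (N choose k)"
    by (metis binomial_absorb_comp binomial_absorption)
  then show ?thesis
    by (metis fact_Suc mult.assoc mult.commute mult.left_commute of_nat_id)
qed

text \<open>The numerator is the falling factorial N (N-1) ... (N-k+1); passing from
  \<open>k\<close> to \<open>Suc k\<close> multiplies the quotient by 1 - k/N, which tends to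
  1.\<close>

lemma choose_over_power_limit:
  "(\<lambda>N. of_nat (fact k * (N choose k)) / of_nat N ^ k :: complex) \<longlonglongrightarrow> 1"
proof (induction k)
  case 0
  then show ?case by simp
next
  case (Suc k)
  have "(\<lambda>N. of_nat (fact k * (N choose k)) / of_nat N ^ k * (1 - of_nat k * inverse (of_nat N)) :: complex)
      \<longlonglongrightarrow> 1 * (1 - of_nat k * 0)"
    by (intro tendsto_intros Suc lim_inverse_n)
  moreover have "\<forall>\<^sub>F N in sequentially. of_nat (fact k * (N choose k)) / of_nat N ^ k * (1 - of_nat k * inverse (of_nat N)) =
      (of_nat (fact (Suc k) * (N choose Suc k)) / of_nat N ^ Suc k :: complex)"
    using eventually_gt_at_top[of k]
  proof eventually_elim
    case (elim N)
    have "fact (Suc k) * (N choose Suc k) = (N - k) * (fact k * (N choose k))"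
      by (rule fact_choose_Suc)
    then have "(of_nat (fact (Suc k) * (N choose Suc k)) :: complex) = of_nat (N - k) * of_nat (fact k * (N choose k))"
      by (metis of_nat_mult)
    also have "(of_nat (N - k) :: complex) = of_nat N - of_nat k" using elim by (simp add: of_nat_diff)
    finally show ?case using elim by (simp add: field_simps)
  qed
  ultimately show ?case using filterlim_cong by (auto elim: Lim_transform_eventually)
qed

lemma higher_pderiv_monom_0:
  fixes c :: complex
  shows "g < k \<Longrightarrow> (pderiv ^^ k) (monom c g) = 0"
  by (rule poly_eqI) (simp add: coeff_higher_pderiv)

text \<open>The point \<open>\<i> / of_nat N\<close> stays in the upper half-plane but tends to 0.
  In the limit only the \<open>b\<close>-th derivative of y^b survives there, and its value b!
  cancels the factorial from the binomial coefficient.\<close>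

lemma heat_limit:
  "(\<lambda>N. heat (1 / of_nat N) N (monom 1 g) (monom 1 b) x (\<i> / of_nat N)) \<longlonglongrightarrow>
     (-1) ^ b * poly ((pderiv ^^ b) (monom 1 g)) x"
proof -
  \<comment> \<open>Higher derivatives of x^g vanish, so for \<open>N\<close> >= \<open>g\<close>
    the sum can be cut at \<open>g\<close>. The number of terms is then independent of
    \<open>N\<close>, and the limit may be taken termwise.\<close>
  define t where "t N k = of_nat (fact k * (N choose k)) / of_nat N ^ k *
    ((-1) ^ k / fact k * poly ((pderiv ^^ k) (monom 1 g)) x * poly ((pderiv ^^ k) (monom 1 b)) (\<i> / of_nat N))"
    for N k
  have "(\<lambda>N. \<Sum>k\<le>g. t N k) \<longlonglongrightarrow>
    (\<Sum>k\<le>g. 1 * ((-1) ^ k / fact k * poly ((pderiv ^^ k) (monom 1 g)) x * poly ((pderiv ^^ k) (monom 1 b)) 0))"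
    unfolding t_def
    by (intro tendsto_intros choose_over_power_limit)
  also have "(\<Sum>k\<le>g. 1 * ((-1) ^ k / fact k * poly ((pderiv ^^ k) (monom 1 g)) x * poly ((pderiv ^^ k) (monom 1 b)) 0)) =
      (\<Sum>k\<le>g. if k = b then (-1) ^ k * poly ((pderiv ^^ k) (monom 1 g)) x else 0)"
    by (rule sum.cong) (auto simp: poly_0_coeff_0 coeff_higher_pderiv pochhammer_fact[symmetric])
  also have "\<dots> = (-1) ^ b * poly ((pderiv ^^ b) (monom 1 g)) x"
    by (auto simp: higher_pderiv_monom_0 not_le)
  finally have lim: "(\<lambda>N. \<Sum>k\<le>g. t N k) \<longlonglongrightarrow> (-1) ^ b * poly ((pderiv ^^ b) (monom 1 g)) x" .
  have "\<forall>\<^sub>F N in sequentially. (\<Sum>k\<le>g. t N k) = heat (1 / of_nat N) N (monom 1 g) (monom 1 b) x (\<i> / of_nat N)"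
    using eventually_ge_at_top[of g]
  proof eventually_elim
    case (elim N)
    have "heat (1 / of_nat N) N (monom 1 g) (monom 1 b) x (\<i> / of_nat N) = (\<Sum>k\<le>N. t N k)"
      unfolding heat_def t_def by (intro sum.cong refl) (simp add: power_minus[of "1 / of_nat N"] power_divide)
    also have "\<dots> = (\<Sum>k\<le>g. t N k)"
      using elim by (intro sum.mono_neutral_right) (auto simp: t_def higher_pderiv_monom_0)
    finally show ?case by simp
  qed
  with lim show ?thesis by (rule Lim_transform_eventually)
qed

subsection \<open>Evaluation of polynomials and operators\<close>

lemma mpow_0 [simp]: "mpow x 0 = 1"
  by (simp add: mpow_def)

lemma mpow_add: "mpow x (\<alpha> + \<beta>) = mpow x \<alpha> * mpow x \<beta>"
  by (simp add: mpow_def lookup_add power_add prod.distrib)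

lemma mpow_mult: "mpow (\<lambda>i. x i * y i) \<alpha> = mpow x \<alpha> * mpow y \<alpha>"
  by (simp add: mpow_def power_mult_distrib prod.distrib)

lemma mpow_single: "mpow x (Poly_Mapping.single i 1) = x i"
proof -
  have "mpow x (Poly_Mapping.single i 1) = (\<Prod>j\<in>UNIV. if j = i then x i else 1)"
    unfolding mpow_def by (rule prod.cong) (auto simp: lookup_single when_def)
  then show ?thesis by simp
qed

lemma meval_superset:
  "finite A \<Longrightarrow> Poly_Mapping.keys f \<subseteq> A \<Longrightarrow>
    meval x f = (\<Sum>\<alpha>\<in>A. Poly_Mapping.lookup f \<alpha> * mpow x \<alpha>)"
  unfolding meval_def by (rule sum.mono_neutral_left) (auto simp: in_keys_iff)

lemma meval_add: "meval x (f + g) = meval x f + meval x g"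
proof -
  let ?A = "Poly_Mapping.keys f \<union> Poly_Mapping.keys g"
  have "Poly_Mapping.keys (f + g) \<subseteq> ?A" by (rule keys_add)
  then show ?thesis
    by (simp add: meval_superset[of ?A] lookup_add distrib_right sum.distrib)
qed

lemma meval_0 [simp]: "meval x 0 = 0"
  by (simp add: meval_def)

lemma meval_sum: "meval x (\<Sum>i\<in>I. f i) = (\<Sum>i\<in>I. meval x (f i))"
  by (induction I rule: infinite_finite_induct) (auto simp: meval_add)

lemma meval_single: "meval x (Poly_Mapping.single \<alpha> c) = c * mpow x \<alpha>"
  by (cases "c = 0") (auto simp: meval_def)

lemma mpoly_sum_single:
  "f = (\<Sum>\<alpha>\<in>Poly_Mapping.keys f. Poly_Mapping.single \<alpha> (Poly_Mapping.lookup f \<alpha>))"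
  by (rule poly_mapping_eqI) (auto simp: lookup_sum lookup_single when_def sum.delta in_keys_iff)

lemma mpoly_mult_sum_single:
  "f * g = (\<Sum>\<alpha>\<in>Poly_Mapping.keys f. \<Sum>\<beta>\<in>Poly_Mapping.keys g.
     Poly_Mapping.single (\<alpha> + \<beta>) (Poly_Mapping.lookup f \<alpha> * Poly_Mapping.lookup g \<beta>))"
  by (subst mpoly_sum_single[of f], subst mpoly_sum_single[of g])
    (simp add: sum_product mult_single)

lemma meval_mult: "meval x (f * g) = meval x f * meval x g"
  unfolding mpoly_mult_sum_single meval_sum meval_single
  by (simp add: meval_def sum_product mpow_add mult_ac)

lemma meval_mconst [simp]: "meval x (mconst c) = c"
  by (simp add: mconst_def meval_single)

lemma meval_1 [simp]: "meval x 1 = 1"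
  using meval_mconst[of x 1] by (simp add: mconst_def)

lemma meval_mvar [simp]: "meval x (mvar i) = x i"
  unfolding mvar_def meval_single mpow_single by simp

lemma meval_power: "meval x (f ^ k) = meval x f ^ k"
  by (induction k) (auto simp: meval_mult)

lemma meval_prod: "meval x (\<Prod>i\<in>I. f i) = (\<Prod>i\<in>I. meval x (f i))"
  by (induction I rule: infinite_finite_induct) (auto simp: meval_mult)

lemma meval_mpow: "meval x (mpow \<sigma> \<alpha>) = mpow (\<lambda>i. meval x (\<sigma> i)) \<alpha>"
  by (simp add: mpow_def meval_prod meval_power)

lemma meval_uminus: "meval x (- f) = - meval x (f :: ('v::finite, complex) mpoly)"
  using meval_add[of x f "- f"] by (simp add: add_eq_0_iff)

lemma meval_msubst: "meval x (msubst \<sigma> f) = meval (\<lambda>i. meval x (\<sigma> i)) f"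
  unfolding msubst_def meval_sum meval_mult meval_mpow meval_mconst
  unfolding meval_def ..

section \<open>Closure properties of polynomials with real coefficients\<close>

definition real_coeffs :: "('v, complex) mpoly \<Rightarrow> bool" where
  "real_coeffs f \<longleftrightarrow> (\<forall>\<alpha>. Poly_Mapping.lookup f \<alpha> \<in> \<real>)"

lemma real_coeffs_sum: "(\<And>i. i \<in> I \<Longrightarrow> real_coeffs (f i)) \<Longrightarrow> real_coeffs (\<Sum>i\<in>I. f i)"
  by (auto simp: real_coeffs_def lookup_sum)

lemma real_coeffs_single: "c \<in> \<real> \<Longrightarrow> real_coeffs (Poly_Mapping.single \<alpha> c)"
  by (auto simp: real_coeffs_def lookup_single when_def)

lemma real_coeffs_mult: "real_coeffs f \<Longrightarrow> real_coeffs g \<Longrightarrow> real_coeffs (f * g)"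
  unfolding mpoly_mult_sum_single
  by (intro real_coeffs_sum real_coeffs_single) (auto simp: real_coeffs_def)

lemma real_coeffs_1: "real_coeffs 1"
  by (auto simp: real_coeffs_def lookup_one when_def)

lemma real_coeffs_power: "real_coeffs f \<Longrightarrow> real_coeffs (f ^ k)"
  by (induction k) (auto intro: real_coeffs_mult real_coeffs_1)

lemma real_coeffs_prod: "(\<And>i. i \<in> I \<Longrightarrow> real_coeffs (f i)) \<Longrightarrow> real_coeffs (\<Prod>i\<in>I. f i)"
  by (induction I rule: infinite_finite_induct) (auto intro: real_coeffs_mult real_coeffs_1)

lemma real_coeffs_mpow: "(\<And>i. real_coeffs (\<sigma> i)) \<Longrightarrow> real_coeffs (mpow \<sigma> \<alpha>)"
  unfolding mpow_def by (intro real_coeffs_prod real_coeffs_power)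

lemma real_coeffs_mconst: "c \<in> \<real> \<Longrightarrow> real_coeffs (mconst c)"
  unfolding mconst_def by (rule real_coeffs_single)

lemma real_coeffs_mvar: "real_coeffs (mvar i)"
  unfolding mvar_def by (rule real_coeffs_single) simp

lemma real_coeffs_uminus: "real_coeffs f \<Longrightarrow> real_coeffs (- f)"
  by (auto simp: real_coeffs_def)

section \<open>Coefficients of iterated derivatives\<close>

lemma lookup_mconst_mult: "Poly_Mapping.lookup (mconst c * f) \<alpha> = c * Poly_Mapping.lookup f \<alpha>"
  unfolding mconst_def mult_map_scale_conv_mult[symmetric]
  by (simp add: Poly_Mapping.map.rep_eq when_def)

lemma lookup_mderiv_funpow:
  "Poly_Mapping.lookup ((mderiv i ^^ k) f) \<alpha> =
     pochhammer (of_nat (Suc (Poly_Mapping.lookup \<alpha> i))) k *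
     Poly_Mapping.lookup f (\<alpha> + Poly_Mapping.single i k)"
proof (induction k arbitrary: \<alpha>)
  case 0
  then show ?case by simp
next
  case (Suc k)
  have "Poly_Mapping.lookup ((mderiv i ^^ Suc k) f) \<alpha> =
      of_nat (Suc (Poly_Mapping.lookup \<alpha> i)) * (pochhammer (of_nat (Suc (Suc (Poly_Mapping.lookup \<alpha> i)))) k *
      Poly_Mapping.lookup f (\<alpha> + Poly_Mapping.single i 1 + Poly_Mapping.single i k))"
    by (simp add: lookup_mderiv Suc lookup_add del: of_nat_Suc)
  also have "\<alpha> + Poly_Mapping.single i 1 + Poly_Mapping.single i k = \<alpha> + Poly_Mapping.single i (Suc k)"
    by (simp add: add.assoc flip: single_add)
  finally show ?case by (simp add: pochhammer_rec algebra_simps)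
qed

lemma poly_mapping_sum_single_UNIV:
  "(\<Sum>i\<in>UNIV. Poly_Mapping.single i (Poly_Mapping.lookup \<beta> i)) = (\<beta> :: 'v::finite \<Rightarrow>\<^sub>0 nat)"
  by (rule poly_mapping_eqI) (simp add: lookup_sum lookup_single when_def)

lemma lookup_mderivs:
  fixes f :: "('v::finite, 'a::comm_semiring_1) mpoly"
  shows "Poly_Mapping.lookup (mderivs \<beta> f) \<alpha> =
     (\<Prod>i\<in>UNIV. pochhammer (of_nat (Suc (Poly_Mapping.lookup \<alpha> i))) (Poly_Mapping.lookup \<beta> i)) *
     Poly_Mapping.lookup f (\<alpha> + \<beta>)"
proof -
  interpret comp_fun_commute "\<lambda>i. (mderiv i :: ('v, 'a) mpoly \<Rightarrow> _) ^^ Poly_Mapping.lookup \<beta> i"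
    by (rule comp_fun_commute_mderiv_funpow)
  \<comment> \<open>For a general finite \<open>K\<close> only the coordinates in \<open>K\<close>
    are shifted; for \<open>UNIV\<close> the sum of singles is \<open>\<beta>\<close>.\<close>
  have "Poly_Mapping.lookup (Finite_Set.fold (\<lambda>i. mderiv i ^^ Poly_Mapping.lookup \<beta> i) f K) \<alpha> =
     (\<Prod>i\<in>K. pochhammer (of_nat (Suc (Poly_Mapping.lookup \<alpha> i))) (Poly_Mapping.lookup \<beta> i)) *
     Poly_Mapping.lookup f (\<alpha> + (\<Sum>i\<in>K. Poly_Mapping.single i (Poly_Mapping.lookup \<beta> i)))"
    if "finite K" for K
    using that
  proof (induction K arbitrary: \<alpha> rule: finite_induct)
    case empty
    then show ?case by simp
  next
    case (insert k K)
    have "(\<Prod>i\<in>K. pochhammer (of_nat (Suc (Poly_Mapping.lookup (\<alpha> + Poly_Mapping.single k (Poly_Mapping.lookup \<beta> k)) i)))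
          (Poly_Mapping.lookup \<beta> i)) =
        (\<Prod>i\<in>K. pochhammer (of_nat (Suc (Poly_Mapping.lookup \<alpha> i)) :: 'a) (Poly_Mapping.lookup \<beta> i))"
      using insert.hyps by (intro prod.cong refl) (auto simp: lookup_add lookup_single when_def)
    then show ?case
      using insert.hyps
      by (simp only: fold_insert prod.insert sum.insert lookup_mderiv_funpow insert.IH add.assoc
          mult.assoc not_False_eq_True)
  qed
  from this[of UNIV] show ?thesis
    by (simp add: mderivs_def poly_mapping_sum_single_UNIV)
qed

lemma mderivs_sum: "mderivs \<beta> (\<Sum>i\<in>I. f i) = (\<Sum>i\<in>I. mderivs \<beta> (f i))"
  by (rule poly_mapping_eqI) (simp add: lookup_mderivs lookup_sum sum_distrib_left)

lemma mderivs_mconst_mult: "mderivs \<beta> (mconst c * f) = mconst c * mderivs \<beta> f"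
  by (rule poly_mapping_eqI) (simp only: lookup_mderivs lookup_mconst_mult mult.left_commute)

lemma real_coeffs_mderivs:
  assumes "real_coeffs f"
  shows "real_coeffs (mderivs \<beta> f)"
proof -
  have "pochhammer (of_nat (Suc m)) k \<in> (\<real> :: complex set)" for m k
    by (simp only: pochhammer_of_nat Reals_of_nat)
  then show ?thesis
    using assms unfolding real_coeffs_def lookup_mderivs
    by (intro allI Reals_mult prod_in_Reals) blast+
qed

section \<open>Products of univariate polynomials\<close>

text \<open>The product of the univariate polynomials \<open>q i\<close>, each in its own variable.\<close>

definition uprod :: "('v::finite \<Rightarrow> complex poly) \<Rightarrow> ('v, complex) mpoly" where
  "uprod q = Poly_Mapping.Abs_poly_mapping (\<lambda>\<alpha>. \<Prod>i\<in>UNIV. coeff (q i) (Poly_Mapping.lookup \<alpha> i))"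

lemma bij_betw_lookup_box:
  "bij_betw Poly_Mapping.lookup {\<alpha> :: 'v::finite \<Rightarrow>\<^sub>0 nat. \<forall>i. Poly_Mapping.lookup \<alpha> i \<le> d i}
     (PiE UNIV (\<lambda>i. {..d i}))"
  by (rule bij_betwI[where g = Poly_Mapping.Abs_poly_mapping])
    (auto simp: PiE_iff intro: poly_mapping_eqI)

lemma finite_exponent_box:
  "finite {\<alpha> :: 'v::finite \<Rightarrow>\<^sub>0 nat. \<forall>i. Poly_Mapping.lookup \<alpha> i \<le> d i}"
  by (subst bij_betw_finite[OF bij_betw_lookup_box]) (intro finite_PiE, auto)

lemma lookup_uprod: "Poly_Mapping.lookup (uprod q) \<alpha> = (\<Prod>i\<in>UNIV. coeff (q i) (Poly_Mapping.lookup \<alpha> i))"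
proof -
  have "{\<alpha>. (\<Prod>i\<in>UNIV. coeff (q i) (Poly_Mapping.lookup \<alpha> i)) \<noteq> 0} \<subseteq>
      {\<alpha>. \<forall>i. Poly_Mapping.lookup \<alpha> i \<le> Polynomial.degree (q i)}"
    by (auto intro: le_degree)
  from finite_subset[OF this finite_exponent_box] show ?thesis
    by (simp add: uprod_def)
qed

text \<open>Expanding a product of univariate sums gives a sum over all choice functions in a box,
  and \<open>lookup\<close> matches these with the exponent vectors.\<close>

lemma meval_uprod: "meval z (uprod q) = (\<Prod>i\<in>UNIV. poly (q i) (z i))"
proof -
  let ?A = "{\<alpha>. \<forall>i. Poly_Mapping.lookup \<alpha> i \<le> Polynomial.degree (q i)}"
  have "Poly_Mapping.keys (uprod q) \<subseteq> ?A"
    by (auto simp: in_keys_iff lookup_uprod intro: le_degree)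
  then have "meval z (uprod q) = (\<Sum>\<alpha>\<in>?A. \<Prod>i\<in>UNIV. coeff (q i) (Poly_Mapping.lookup \<alpha> i) * z i ^ Poly_Mapping.lookup \<alpha> i)"
    by (subst meval_superset[OF finite_exponent_box]) (auto simp: lookup_uprod mpow_def prod.distrib)
  also have "\<dots> = (\<Sum>k\<in>PiE UNIV (\<lambda>i. {..Polynomial.degree (q i)}). \<Prod>i\<in>UNIV. coeff (q i) (k i) * z i ^ k i)"
    by (rule sum.reindex_bij_betw[OF bij_betw_lookup_box])
  also have "\<dots> = (\<Prod>i\<in>UNIV. \<Sum>k\<le>Polynomial.degree (q i). coeff (q i) k * z i ^ k)"
    by (rule prod_sum_PiE[symmetric]) auto
  finally show ?thesis by (simp add: poly_altdef)
qed

lemma mderivs_uprod: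
  "mderivs \<beta> (uprod q) = uprod (\<lambda>i. (pderiv ^^ Poly_Mapping.lookup \<beta> i) (q i))"
  by (rule poly_mapping_eqI)
    (simp add: lookup_mderivs lookup_uprod lookup_add coeff_higher_pderiv prod.distrib)

text \<open>Together with \<open>mderivs_uprod\<close> this reduces derivatives of monomials to
  univariate derivatives.\<close>

lemma single_conv_uprod:
  "Poly_Mapping.single \<gamma> c = mconst c * uprod (\<lambda>j. monom 1 (Poly_Mapping.lookup \<gamma> j))"
proof (rule poly_mapping_eqI)
  fix \<alpha>
  show "Poly_Mapping.lookup (Poly_Mapping.single \<gamma> c) \<alpha> =
      Poly_Mapping.lookup (mconst c * uprod (\<lambda>j. monom 1 (Poly_Mapping.lookup \<gamma> j))) \<alpha>"
  proof (cases "\<gamma> = \<alpha>")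
    case False
    then obtain i where "Poly_Mapping.lookup \<gamma> i \<noteq> Poly_Mapping.lookup \<alpha> i"
      by (auto simp: poly_mapping_eq_iff fun_eq_iff)
    then have "(\<Prod>j\<in>UNIV. coeff (monom 1 (Poly_Mapping.lookup \<gamma> j)) (Poly_Mapping.lookup \<alpha> j)) = (0 :: complex)"
      by (intro prod_zero) auto
    with False show ?thesis by (simp add: lookup_mconst_mult lookup_uprod lookup_single)
  qed (simp add: lookup_mconst_mult lookup_uprod)
qed

section \<open>Symbols and operators as functions\<close>

definition symb ::
  "(('n::finite \<Rightarrow>\<^sub>0 nat) \<times> ('n \<Rightarrow>\<^sub>0 nat) \<Rightarrow>\<^sub>0 real) \<Rightarrow> ('n \<Rightarrow> complex) \<Rightarrow> ('n \<Rightarrow> complex) \<Rightarrow> complex" where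
  "symb a z w = (\<Sum>(\<alpha>, \<beta>)\<in>Poly_Mapping.keys a.
     of_real (Poly_Mapping.lookup a (\<alpha>, \<beta>)) * mpow z \<alpha> * mpow w \<beta>)"

lemma meval_negate_symbol:
  "meval x (negate_w (weyl_symbol a)) = symb a (\<lambda>i. x (Inl i)) (\<lambda>i. - x (Inr i))"
  unfolding negate_w_def meval_msubst weyl_symbol_def meval_sum symb_def
  by (simp add: meval_mult meval_mpow meval_uminus case_prod_unfold)

lemma meval_weyl_op:
  "meval z (weyl_op a f) = (\<Sum>(\<alpha>, \<beta>)\<in>Poly_Mapping.keys a.
     of_real (Poly_Mapping.lookup a (\<alpha>, \<beta>)) * mpow z \<alpha> * meval z (mderivs \<beta> f))"
  unfolding weyl_op_def meval_sum by (simp add: meval_mult meval_mpow case_prod_unfold)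

lemma meval_weyl_op_uprod:
  "meval z (weyl_op a (uprod q)) = (\<Sum>(\<alpha>, \<beta>)\<in>Poly_Mapping.keys a.
     of_real (Poly_Mapping.lookup a (\<alpha>, \<beta>)) * mpow z \<alpha> *
     (\<Prod>j\<in>UNIV. poly ((pderiv ^^ Poly_Mapping.lookup \<beta> j) (q j)) (z j)))"
  unfolding meval_weyl_op mderivs_uprod meval_uprod ..

lemma real_coeffs_weyl_op: "real_coeffs f \<Longrightarrow> real_coeffs (weyl_op a f)"
  unfolding weyl_op_def case_prod_unfold
  by (intro real_coeffs_sum real_coeffs_mult real_coeffs_mconst real_coeffs_mpow real_coeffs_mvar
      real_coeffs_mderivs) auto

lemma real_coeffs_negate_symbol: "real_coeffs (negate_w (weyl_symbol a))"
proof -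
  have "real_coeffs (weyl_symbol a)"
    unfolding weyl_symbol_def case_prod_unfold
    by (intro real_coeffs_sum real_coeffs_mult real_coeffs_mconst real_coeffs_mpow real_coeffs_mvar) auto
  then show ?thesis
    unfolding negate_w_def msubst_def
    by (intro real_coeffs_sum real_coeffs_mult real_coeffs_mconst real_coeffs_mpow)
      (auto simp: real_coeffs_def[of "weyl_symbol a"] split: sum.split
        intro: real_coeffs_mvar real_coeffs_uminus)
qed

lemma real_stable_iff: "f \<in> real_stable \<longleftrightarrow> (\<forall>z\<in>upper. meval z f \<noteq> 0) \<and> real_coeffs f"
  by (auto simp: real_stable_def stable_def upper_def real_coeffs_def)

text \<open>A polynomial vanishing on an infinite grid is zero. The induction removes one variable
  at a time, comparing coefficients of a univariate polynomial with infinitely many roots.\<close>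

lemma sum_monomials_eq_0_imp:
  fixes A :: "('v::finite \<Rightarrow>\<^sub>0 nat) set" and c :: "('v \<Rightarrow>\<^sub>0 nat) \<Rightarrow> complex"
  assumes X: "infinite X" and A: "finite A"
    and zero: "\<And>x. (\<And>i. x i \<in> X) \<Longrightarrow> (\<Sum>\<alpha>\<in>A. c \<alpha> * mpow x \<alpha>) = 0"
    and "\<alpha> \<in> A"
  shows "c \<alpha> = 0"
proof -
  have "c \<alpha> = 0"
    if "finite K" "finite A"
      "\<And>\<alpha> \<beta>. \<alpha> \<in> A \<Longrightarrow> \<beta> \<in> A \<Longrightarrow> (\<And>i. i \<in> K \<Longrightarrow> Poly_Mapping.lookup \<alpha> i = Poly_Mapping.lookup \<beta> i) \<Longrightarrow> \<alpha> = \<beta>"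
      "\<And>x. (\<And>i. x i \<in> X) \<Longrightarrow> (\<Sum>\<alpha>\<in>A. c \<alpha> * (\<Prod>i\<in>K. x i ^ Poly_Mapping.lookup \<alpha> i)) = 0"
      "\<alpha> \<in> A" for A K \<alpha>
    using that
  proof (induction K arbitrary: A \<alpha> rule: finite_induct)
    case empty
    obtain x0 where "x0 \<in> X" using X infinite_imp_nonempty by blast
    have "A = {\<alpha>}" using empty.prems by blast
    then show ?case using empty.prems(3)[of "\<lambda>_. x0"] \<open>x0 \<in> X\<close> by simp
  next
    case (insert k K)
    let ?n = "Poly_Mapping.lookup \<alpha> k"
    \<comment> \<open>The coefficient of y^\<open>?n\<close> collects exactly the exponents in
      \<open>?B\<close>. They agree at \<open>k\<close>, so the variables in \<open>K\<close> alone
      still separate them.\<close>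
    let ?B = "{\<beta> \<in> A. Poly_Mapping.lookup \<beta> k = ?n}"
    show ?case
    proof (rule insert.IH[of ?B \<alpha>])
      show "finite ?B" "\<alpha> \<in> ?B" using insert.prems by auto
      show "\<beta> = \<gamma>" if "\<beta> \<in> ?B" "\<gamma> \<in> ?B"
        "\<And>i. i \<in> K \<Longrightarrow> Poly_Mapping.lookup \<beta> i = Poly_Mapping.lookup \<gamma> i" for \<beta> \<gamma>
        using that by (intro insert.prems(2)) auto
      fix x :: "'v \<Rightarrow> complex" assume x: "\<And>i. x i \<in> X"
      define P where "P = (\<Sum>\<beta>\<in>A. monom (c \<beta> * (\<Prod>i\<in>K. x i ^ Poly_Mapping.lookup \<beta> i)) (Poly_Mapping.lookup \<beta> k))"
      have "poly P y = 0" if y: "y \<in> X" for y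
      proof -
        have "poly P y = (\<Sum>\<beta>\<in>A. c \<beta> * (\<Prod>i\<in>insert k K. (x(k := y)) i ^ Poly_Mapping.lookup \<beta> i))"
          unfolding P_def poly_sum
        proof (rule sum.cong[OF refl])
          fix \<beta>
          have "(\<Prod>i\<in>K. (x(k := y)) i ^ Poly_Mapping.lookup \<beta> i) = (\<Prod>i\<in>K. x i ^ Poly_Mapping.lookup \<beta> i)"
            using insert.hyps by (intro prod.cong) auto
          then show "poly (monom (c \<beta> * (\<Prod>i\<in>K. x i ^ Poly_Mapping.lookup \<beta> i)) (Poly_Mapping.lookup \<beta> k)) y =
              c \<beta> * (\<Prod>i\<in>insert k K. (x(k := y)) i ^ Poly_Mapping.lookup \<beta> i)"
            using insert.hyps by (simp add: poly_monom)
        qed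
        also have "\<dots> = 0" by (rule insert.prems(3)) (use x y in auto)
        finally show ?thesis .
      qed
      then have "X \<subseteq> {y. poly P y = 0}" by auto
      then have "P = 0" using X poly_roots_finite finite_subset by blast
      then have "coeff P ?n = 0" by simp
      also have "coeff P ?n = (\<Sum>\<beta>\<in>?B. c \<beta> * (\<Prod>i\<in>K. x i ^ Poly_Mapping.lookup \<beta> i))"
        unfolding P_def coeff_sum coeff_monom
        using insert.prems(1) by (intro sum.mono_neutral_cong_right) auto
      finally show "(\<Sum>\<beta>\<in>?B. c \<beta> * (\<Prod>i\<in>K. x i ^ Poly_Mapping.lookup \<beta> i)) = 0" .
    qed
  qed
  from this[of UNIV A \<alpha>] show ?thesis
    using assms by (auto simp: mpow_def poly_mapping_eq_iff fun_eq_iff)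
qed

lemma meval_eq_0_imp:
  fixes f :: "('v::finite, complex) mpoly"
  assumes "\<And>z. meval z f = 0"
  shows "f = 0"
proof (rule ccontr)
  assume "f \<noteq> 0"
  then obtain \<alpha> where \<alpha>: "\<alpha> \<in> Poly_Mapping.keys f" by (metis keys_eq_empty ex_in_conv)
  have "Poly_Mapping.lookup f \<alpha> = 0"
    by (rule sum_monomials_eq_0_imp[of UNIV "Poly_Mapping.keys f"])
      (use assms \<alpha> in \<open>auto simp: meval_def infinite_UNIV_char_0\<close>)
  with \<alpha> show False by (simp add: in_keys_iff)
qed

section \<open>Stability of the symbol implies preservation\<close>

lemma poly_seq_poly_coord:
  assumes "\<And>N. Polynomial.degree (P N) \<le> d"
  shows "poly_seq (\<lambda>N z. poly (P N) (z j))"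
  unfolding poly_seq_def
proof (intro exI allI conjI)
  fix N and z l :: "'a \<Rightarrow> complex" and t
  show "Polynomial.degree (pcompose (P N) [:z j, l j:]) \<le> d"
    using assms[of N] by (simp add: degree_pcompose)
  show "poly (P N) (z j + t * l j) = poly (pcompose (P N) [:z j, l j:]) t"
    by (simp add: poly_pcompose)
qed

text \<open>The number of summands grows with \<open>N\<close>, so closure under fixed finite sums
  does not suffice; the degree is nevertheless bounded by that of \<open>p\<close>.\<close>

lemma poly_seq_heat: "poly_seq (\<lambda>N z. heat (e N) N p q (z j) (y N))"
proof -
  have "poly_seq (\<lambda>N z. poly (\<Sum>k\<le>N. smult (of_nat (N choose k) * ((- e N) ^ k * poly ((pderiv ^^ k) q) (y N)))
      ((pderiv ^^ k) p)) (z j))"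
    by (rule poly_seq_poly_coord[of _ "Polynomial.degree p"])
      (auto intro!: degree_sum_le order.trans[OF degree_smult_le] simp: degree_higher_pderiv)
  then show ?thesis by (simp add: heat_def poly_sum mult_ac)
qed

lemma poly_seq_meval: "poly_seq (\<lambda>_ z. meval z f)"
  unfolding meval_def by (intro poly_seq_sum poly_seq_mult poly_seq_const poly_seq_mpow)

text \<open>\<open>F N\<close> has no zeros in \<open>upper\<close> for positive \<open>N\<close>
  and converges to T f; a zero of T f at \<open>z0\<close> therefore spreads to every point by
  Hurwitz.\<close>

lemma weyl_op_stable_or_0:
  fixes a :: "('n::finite \<Rightarrow>\<^sub>0 nat) \<times> ('n \<Rightarrow>\<^sub>0 nat) \<Rightarrow>\<^sub>0 real"
  assumes a: "\<And>z w. z \<in> upper \<Longrightarrow> w \<in> upper \<Longrightarrow> symb a z (\<lambda>i. - w i) \<noteq> 0"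
    and f: "\<And>z. z \<in> upper \<Longrightarrow> meval z f \<noteq> 0"
    and z0: "z0 \<in> upper" "meval z0 (weyl_op a f) = 0"
  shows "weyl_op a f = 0"
proof (rule meval_eq_0_imp)
  fix z1
  define I where "I = Poly_Mapping.keys f \<times> Poly_Mapping.keys a"
  \<comment> \<open>The sign from replacing w by -w is stored in the coefficient; it later cancels
    against the sign produced by \<open>heat_limit\<close>.\<close>
  define c where "c z i = (case i of (\<gamma>, \<alpha>, \<beta>) \<Rightarrow> Poly_Mapping.lookup f \<gamma> *
    (of_real (Poly_Mapping.lookup a (\<alpha>, \<beta>)) * (mpow (\<lambda>_. - 1) \<beta> * mpow z \<alpha>)))" for z i
  define g where "g i = Poly_Mapping.lookup (fst i)"
    for i :: "('n \<Rightarrow>\<^sub>0 nat) \<times> ('n \<Rightarrow>\<^sub>0 nat) \<times> ('n \<Rightarrow>\<^sub>0 nat)"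
  define b where "b i = Poly_Mapping.lookup (snd (snd i))"
    for i :: "('n \<Rightarrow>\<^sub>0 nat) \<times> ('n \<Rightarrow>\<^sub>0 nat) \<times> ('n \<Rightarrow>\<^sub>0 nat)"
  \<comment> \<open>In \<open>c z i\<close> the point z is a frozen parameter while the operators
    act on a separate variable v. Only afterwards is v set to z, so the factors
    z^\<open>\<alpha>\<close> are not differentiated.\<close>
  define F where "F N z = (\<Sum>i\<in>I. c z i *
    (\<Prod>j\<in>UNIV. heat (1 / of_nat N) N (monom 1 (g i j)) (monom 1 (b i j)) (z j) (\<i> / of_nat N)))" for N z
  show "meval z1 (weyl_op a f) = 0"
  proof (rule Hurwitz_upper[of F "\<lambda>z. meval z (weyl_op a f)" z0 z1])
    show "poly_seq F"
      unfolding F_def c_def case_prod_unfold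
      by (intro poly_seq_sum poly_seq_mult poly_seq_const poly_seq_mpow poly_seq_prod poly_seq_heat)
    show "poly_seq (\<lambda>_ z. meval z (weyl_op a f))" by (rule poly_seq_meval)
    show "\<forall>\<^sub>F N in sequentially. \<forall>z\<in>upper. F N z \<noteq> 0"
      using eventually_gt_at_top[of 0]
    proof (eventually_elim, intro ballI)
      fix N :: nat and z :: "'n \<Rightarrow> complex" assume N: "N > 0" and z: "z \<in> upper"
      have "(\<Sum>i\<in>I. c z i * (\<Prod>j\<in>UNIV. v j ^ g i j * w j ^ b i j)) \<noteq> 0"
        if "v \<in> upper" "w \<in> upper" for v w
      proof -
        have "meval v f * symb a z (\<lambda>i. - w i) =
            (\<Sum>i\<in>I. c z i * (\<Prod>j\<in>UNIV. v j ^ g i j * w j ^ b i j))"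
          unfolding meval_def symb_def sum_product sum.cartesian_product I_def
        proof (intro sum.cong refl)
          fix i assume "i \<in> Poly_Mapping.keys f \<times> Poly_Mapping.keys a"
          obtain \<gamma> \<alpha> \<beta> where i: "i = (\<gamma>, \<alpha>, \<beta>)" by (cases i) auto
          have "mpow (\<lambda>i. - w i) \<beta> = mpow (\<lambda>_. - 1) \<beta> * mpow w \<beta>"
            using mpow_mult[of "\<lambda>_. - 1" w \<beta>] by simp
          then show "(case i of (\<alpha>, \<beta>) \<Rightarrow> Poly_Mapping.lookup f \<alpha> * mpow v \<alpha> *
             (case \<beta> of (\<alpha>, \<beta>) \<Rightarrow> complex_of_real (Poly_Mapping.lookup a (\<alpha>, \<beta>)) *
               mpow z \<alpha> * mpow (\<lambda>i. - w i) \<beta>)) =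
             c z i * (\<Prod>j\<in>UNIV. v j ^ g i j * w j ^ b i j)"
            by (simp add: i c_def g_def b_def prod.distrib mult_ac flip: mpow_def)
        qed
        then show ?thesis using a[OF z that(2)] f[OF that(1)] by auto
      qed
      from heat_monom_nonzero[of I "1 / of_nat N" UNIV "c z" g b z "\<lambda>_. \<i> / of_nat N" N, OF _ _ _ this]
      show "F N z \<noteq> 0"
        using N z by (simp add: I_def F_def upper_def Im_divide_of_nat)
    qed
    show "(\<lambda>N. F N z) \<longlonglongrightarrow> meval z (weyl_op a f)" for z
    proof -
      have "(\<lambda>N. F N z) \<longlonglongrightarrow> (\<Sum>i\<in>I. c z i *
          (\<Prod>j\<in>UNIV. (- 1) ^ b i j * poly ((pderiv ^^ b i j) (monom 1 (g i j))) (z j)))"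
        unfolding F_def by (intro tendsto_intros heat_limit)
      also have "(\<Sum>i\<in>I. c z i *
          (\<Prod>j\<in>UNIV. (- 1) ^ b i j * poly ((pderiv ^^ b i j) (monom 1 (g i j))) (z j))) =
          (\<Sum>\<gamma>\<in>Poly_Mapping.keys f. \<Sum>(\<alpha>, \<beta>)\<in>Poly_Mapping.keys a. Poly_Mapping.lookup f \<gamma> *
          (of_real (Poly_Mapping.lookup a (\<alpha>, \<beta>)) * mpow z \<alpha> *
           (\<Prod>j\<in>UNIV. poly ((pderiv ^^ Poly_Mapping.lookup \<beta> j) (monom 1 (Poly_Mapping.lookup \<gamma> j))) (z j))))"
        unfolding sum.cartesian_product I_def
      proof (intro sum.cong refl)
        fix i assume "i \<in> Poly_Mapping.keys f \<times> Poly_Mapping.keys a"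
        obtain \<gamma> \<alpha> \<beta> where i: "i = (\<gamma>, \<alpha>, \<beta>)" by (cases i) auto
        have "mpow (\<lambda>_. - 1) \<beta> * mpow (\<lambda>_. - 1) \<beta> = (1 :: complex)"
          unfolding mpow_mult[symmetric] by (simp add: mpow_def)
        then have *: "mpow (\<lambda>_. - 1) \<beta> * (mpow (\<lambda>_. - 1) \<beta> * x) = x" for x :: complex
          by (metis mult.assoc mult_1)
        have "(\<Prod>j\<in>UNIV. (- 1) ^ b i j * poly ((pderiv ^^ b i j) (monom 1 (g i j))) (z j)) =
            mpow (\<lambda>_. - 1) \<beta> *
            (\<Prod>j\<in>UNIV. poly ((pderiv ^^ Poly_Mapping.lookup \<beta> j) (monom 1 (Poly_Mapping.lookup \<gamma> j))) (z j))"
          by (simp add: i b_def g_def prod.distrib mpow_def)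
        then show "c z i * (\<Prod>j\<in>UNIV. (- 1) ^ b i j * poly ((pderiv ^^ b i j) (monom 1 (g i j))) (z j)) =
          (case i of (\<gamma>, \<alpha>, \<beta>) \<Rightarrow> Poly_Mapping.lookup f \<gamma> *
          (of_real (Poly_Mapping.lookup a (\<alpha>, \<beta>)) * mpow z \<alpha> *
           (\<Prod>j\<in>UNIV. poly ((pderiv ^^ Poly_Mapping.lookup \<beta> j) (monom 1 (Poly_Mapping.lookup \<gamma> j))) (z j))))"
          by (simp add: i c_def mult_ac *)
      qed
      also have "\<dots> = meval z (weyl_op a f)"
      proof -
        have "meval z (mderivs \<beta> f) = (\<Sum>\<gamma>\<in>Poly_Mapping.keys f. Poly_Mapping.lookup f \<gamma> *
            (\<Prod>j\<in>UNIV. poly ((pderiv ^^ Poly_Mapping.lookup \<beta> j) (monom 1 (Poly_Mapping.lookup \<gamma> j))) (z j)))" for \<beta>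
          by (subst mpoly_sum_single[of f])
            (simp add: mderivs_sum single_conv_uprod mderivs_mconst_mult mderivs_uprod meval_sum
              meval_mult meval_uprod)
        then show ?thesis
          unfolding meval_weyl_op
          by (subst sum.swap) (simp add: sum_distrib_left case_prod_unfold mult_ac)
      qed
      finally show ?thesis .
    qed
  qed (use z0 in auto)
qed

subsection \<open>Real stability preservers\<close>

lemma higher_pderiv_mult:
  fixes p q :: "complex poly"
  shows "(pderiv ^^ k) (p * q) =
     (\<Sum>i\<le>k. of_nat (k choose i) * ((pderiv ^^ i) p * (pderiv ^^ (k - i)) q))"
proof (induction k)
  case 0
  then show ?case by simp
next
  case (Suc k)
  have "(pderiv ^^ Suc k) (p * q) =
      (\<Sum>i\<le>k. of_nat (k choose i) *
        ((pderiv ^^ i) p * (pderiv ^^ (Suc k - i)) q + (pderiv ^^ Suc i) p * (pderiv ^^ (Suc k - Suc i)) q))"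
  proof -
    have "(pderiv ^^ Suc k) (p * q) =
        pderiv (\<Sum>i\<le>k. of_nat (k choose i) * ((pderiv ^^ i) p * (pderiv ^^ (k - i)) q))"
      by (simp only: funpow.simps o_apply Suc)
    also have "\<dots> = (\<Sum>i\<le>k. pderiv (of_nat (k choose i) * ((pderiv ^^ i) p * (pderiv ^^ (k - i)) q)))"
      using higher_pderiv_sum[of 1] by (simp only: One_nat_def funpow.simps o_id)
    also have "\<dots> = (\<Sum>i\<le>k. of_nat (k choose i) *
        ((pderiv ^^ i) p * (pderiv ^^ (Suc k - i)) q + (pderiv ^^ Suc i) p * (pderiv ^^ (Suc k - Suc i)) q))"
    proof (rule sum.cong[OF refl])
      fix i assume "i \<in> {..k}"
      then have *: "Suc k - i = Suc (k - i)" by (simp add: Suc_diff_le)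
      show "pderiv (of_nat (k choose i) * ((pderiv ^^ i) p * (pderiv ^^ (k - i)) q)) = of_nat (k choose i) *
        ((pderiv ^^ i) p * (pderiv ^^ (Suc k - i)) q + (pderiv ^^ Suc i) p * (pderiv ^^ (Suc k - Suc i)) q)"
        unfolding * by (simp only: pderiv_mult pderiv_of_nat funpow.simps o_apply diff_Suc_Suc mult_zero_right
            mult_zero_left add_0_right) (simp only: mult.commute)
    qed
    finally show ?thesis .
  qed
  also have "\<dots> = (\<Sum>i\<le>Suc k. of_nat (Suc k choose i) * ((pderiv ^^ i) p * (pderiv ^^ (Suc k - i)) q))"
    by (rule sum_choose_Suc[symmetric])
  finally show ?case .
qed

lemma higher_pderiv_linear_power:
  fixes v :: complex
  shows "(pderiv ^^ i) ([:1, v:] ^ N) = smult (v ^ i * of_nat (fact i * (N choose i))) ([:1, v:] ^ (N - i))"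
proof (induction i)
  case 0
  then show ?case by simp
next
  case (Suc i)
  have "(pderiv ^^ Suc i) ([:1, v:] ^ N) =
      smult (v ^ i * of_nat (fact i * (N choose i))) (pderiv ([:1, v:] ^ (N - i)))"
    by (simp add: Suc pderiv_smult)
  also have "pderiv ([:1, v:] ^ (N - i)) = smult (of_nat (N - i) * v) ([:1, v:] ^ (N - Suc i))"
    by (simp add: pderiv_power pderiv_pCons)
  also have "smult (v ^ i * of_nat (fact i * (N choose i))) (smult (of_nat (N - i) * v) ([:1, v:] ^ (N - Suc i))) =
      smult (v ^ Suc i * of_nat ((N - i) * (fact i * (N choose i)))) ([:1, v:] ^ (N - Suc i))"
    by (simp add: mult_ac)
  finally show ?case unfolding fact_choose_Suc .
qed

text \<open>The polynomial \<open>(\<partial> + s)\<^sup>k h\<close>.\<close>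

definition twist :: "complex \<Rightarrow> nat \<Rightarrow> complex poly \<Rightarrow> complex poly" where
  "twist s k h = (\<Sum>i\<le>k. smult (of_nat (k choose i) * s ^ (k - i)) ((pderiv ^^ i) h))"

lemma twist_add: "twist s k (p + q) = twist s k p + twist s k q"
  by (simp add: twist_def higher_pderiv_add smult_add_right sum.distrib)

lemma twist_smult: "twist s k (smult c p) = smult c (twist s k p)"
  by (rule poly_eqI) (simp only: twist_def higher_pderiv_smult coeff_sum coeff_smult sum_distrib_left mult.left_commute)

lemma twist_1: "poly (twist s k 1) x = s ^ k"
proof -
  have "poly (twist s k 1) x = (\<Sum>i\<le>k. if i = 0 then s ^ k else 0)"
    unfolding twist_def poly_sum
  proof (intro sum.cong refl)
    fix i
    show "poly (smult (of_nat (k choose i) * s ^ (k - i)) ((pderiv ^^ i) 1)) x = (if i = 0 then s ^ k else 0)"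
      using higher_pderiv_monom_0[of 0 i 1] by (cases i) (auto simp: monom_0 simp flip: one_pCons)
  qed
  then show ?thesis by simp
qed

text \<open>Proper derivatives of \<open>h\<close> have smaller degree or vanish, so only the
  summand without a derivative contributes at infinity.\<close>

lemma twist_ratio_limit:
  assumes h: "h \<noteq> 0"
  shows "((\<lambda>x. poly (twist s k h) x / poly h x) \<longlongrightarrow> s ^ k) at_infinity"
proof -
  have nz: "\<forall>\<^sub>F x in at_infinity. poly h x \<noteq> 0"
  proof (cases "Polynomial.degree h = 0")
    case True
    then obtain c where "h = [:c:]" by (metis degree_eq_zeroE)
    with h show ?thesis by simp
  next
    case False
    then show ?thesis
      by (intro filterlim_at_infinity_imp_eventually_ne filterlim_poly_at_infinity) auto
  qed
  have ratio: "((\<lambda>x. poly ((pderiv ^^ i) h) x / poly h x) \<longlongrightarrow> (if i = 0 then 1 else 0)) at_infinity" for i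
  proof (cases "i = 0 \<or> Polynomial.degree h = 0")
    case False
    then have "((\<lambda>x. poly ((pderiv ^^ i) h) x / poly h x) \<longlongrightarrow> 0) at_infinity"
      by (intro poly_divide_tendsto_0_at_infinity) (auto simp: degree_higher_pderiv)
    with False show ?thesis by simp
  next
    case True
    show ?thesis
    proof (cases "i = 0")
      case True
      have "\<forall>\<^sub>F x in at_infinity. poly h x / poly h x = 1"
        using nz by eventually_elim simp
      with True show ?thesis by (simp add: tendsto_eventually)
    next
      case False
      with True obtain c where "h = [:c:]" by (metis degree_eq_zeroE)
      then have "(pderiv ^^ i) h = 0"
        using False higher_pderiv_monom_0[of 0 i c] by (simp add: monom_0)
      with False show ?thesis by simp
    qed
  qed
  have "((\<lambda>x. \<Sum>i\<le>k. of_nat (k choose i) * s ^ (k - i) * (poly ((pderiv ^^ i) h) x / poly h x)) \<longlongrightarrow>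
      (\<Sum>i\<le>k. of_nat (k choose i) * s ^ (k - i) * (if i = 0 then 1 else 0))) at_infinity"
    by (intro tendsto_sum tendsto_mult tendsto_const ratio)
  also have "(\<Sum>i\<le>k. of_nat (k choose i) * s ^ (k - i) * (if i = 0 then 1 else 0)) = s ^ k"
  proof -
    have "(\<Sum>i\<le>k. of_nat (k choose i) * s ^ (k - i) * (if i = 0 then 1 else 0)) =
        (\<Sum>i\<le>k. if i = 0 then s ^ k else 0)"
      by (rule sum.cong) auto
    then show ?thesis by simp
  qed
  finally show ?thesis
    by (simp add: twist_def poly_sum sum_divide_distrib)
qed

text \<open>
  The value of \<open>exp(-s z) T (exp(s z) h\<^sub>1(z\<^sub>1) \<cdots> h\<^sub>n(z\<^sub>n))\<close>, that is, of the operator with symbol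
  \<open>F(z, w + s)\<close> on a product of univariate polynomials.
\<close>

definition shifted_op ::
  "(('n::finite \<Rightarrow>\<^sub>0 nat) \<times> ('n \<Rightarrow>\<^sub>0 nat) \<Rightarrow>\<^sub>0 real) \<Rightarrow> ('n \<Rightarrow> complex) \<Rightarrow> ('n \<Rightarrow> complex poly) \<Rightarrow>
   ('n \<Rightarrow> complex) \<Rightarrow> complex" where
  "shifted_op a s h z = (\<Sum>(\<alpha>, \<beta>)\<in>Poly_Mapping.keys a.
     of_real (Poly_Mapping.lookup a (\<alpha>, \<beta>)) * mpow z \<alpha> *
     (\<Prod>j\<in>UNIV. poly (twist (s j) (Poly_Mapping.lookup \<beta> j) (h j)) (z j)))"

lemma shifted_op_1: "shifted_op a s (\<lambda>_. 1) z = symb a z s"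
  unfolding shifted_op_def symb_def twist_1 by (simp add: mpow_def)

lemma shifted_op_linear:
  "shifted_op a s (h(j := smult c p + smult d q)) z =
     c * shifted_op a s (h(j := p)) z + d * shifted_op a s (h(j := q)) z"
proof -
  have *: "(\<Prod>i\<in>UNIV. poly (twist (s i) (Poly_Mapping.lookup \<beta> i) ((h(j := r)) i)) (z i)) =
      poly (twist (s j) (Poly_Mapping.lookup \<beta> j) r) (z j) *
      (\<Prod>i\<in>UNIV-{j}. poly (twist (s i) (Poly_Mapping.lookup \<beta> i) (h i)) (z i))" for r \<beta>
    by (subst prod.remove[of _ j]) (auto intro!: prod.cong)
  show ?thesis
    unfolding shifted_op_def * sum_distrib_left sum.distrib[symmetric]
    by (rule sum.cong) (auto simp: twist_add twist_smult algebra_simps)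
qed

lemma poly_seq_shifted_op: "poly_seq (\<lambda>_ z. shifted_op a s h z)"
  unfolding shifted_op_def case_prod_unfold
  by (intro poly_seq_sum poly_seq_mult poly_seq_const poly_seq_mpow poly_seq_prod poly_seq_poly poly_seq_coord)

section \<open>Growth along rays and the part of top degree\<close>

definition total :: "('n::finite \<Rightarrow>\<^sub>0 nat) \<Rightarrow> nat" where
  "total \<alpha> = (\<Sum>j\<in>UNIV. Poly_Mapping.lookup \<alpha> j)"

lemma mpow_scale: "mpow (\<lambda>j. c * x j) \<alpha> = c ^ total \<alpha> * mpow x \<alpha>"
  by (simp add: mpow_def total_def power_mult_distrib prod.distrib power_sum)

text \<open>Each term splits into z^\<open>\<alpha>\<close> / y^d, which survives only for
  \<open>total \<alpha> = d\<close>, and ratios governed by \<open>twist_ratio_limit\<close>. The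
  limit does not depend on \<open>h\<close>, which allows different choices of \<open>h\<close> to
  be compared.\<close>

lemma shifted_op_asymptotic:
  fixes l :: "'n::finite \<Rightarrow> real"
  assumes l: "\<And>j. l j > 0" and h: "\<And>j. h j \<noteq> 0"
    and d: "\<And>\<alpha> \<beta>. (\<alpha>, \<beta>) \<in> Poly_Mapping.keys a \<Longrightarrow> total \<alpha> \<le> d"
  shows "((\<lambda>y. shifted_op a s h (\<lambda>j. \<i> * of_real (y * l j)) /
      (of_real y ^ d * (\<Prod>j\<in>UNIV. poly (h j) (\<i> * of_real (y * l j))))) \<longlongrightarrow>
    (\<Sum>(\<alpha>, \<beta>)\<in>Poly_Mapping.keys a. if total \<alpha> = d
      then of_real (Poly_Mapping.lookup a (\<alpha>, \<beta>)) * mpow (\<lambda>j. \<i> * of_real (l j)) \<alpha> * mpow s \<beta> else 0)) at_top"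
proof -
  define z where "z y j = \<i> * complex_of_real (y * l j)" for y j
  have z_lim: "filterlim (\<lambda>y. z y j) at_infinity at_top" for j
  proof -
    have "filterlim (\<lambda>y. y * l j) at_top at_top"
      using l by (intro filterlim_at_top_mult_tendsto_pos[OF tendsto_const] filterlim_ident)
    then have "filterlim (\<lambda>y. norm (z y j)) at_top at_top"
      unfolding z_def norm_mult norm_of_real norm_ii mult_1
      by (rule filterlim_compose[OF filterlim_abs_real])
    then show ?thesis by (rule filterlim_norm_at_top_imp_at_infinity)
  qed
  have ratio: "((\<lambda>y. poly (twist (s j) k (h j)) (z y j) / poly (h j) (z y j)) \<longlongrightarrow> s j ^ k) at_top" for j k
    by (rule filterlim_compose[OF twist_ratio_limit[OF h] z_lim])
  have mono: "((\<lambda>y. mpow (z y) \<alpha> / of_real y ^ d) \<longlongrightarrow>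
      (if total \<alpha> = d then mpow (\<lambda>j. \<i> * of_real (l j)) \<alpha> else 0)) at_top" if "total \<alpha> \<le> d" for \<alpha>
  proof -
    have "((\<lambda>y. inverse (complex_of_real y) ^ (d - total \<alpha>) * mpow (\<lambda>j. \<i> * of_real (l j)) \<alpha>) \<longlongrightarrow>
        0 ^ (d - total \<alpha>) * mpow (\<lambda>j. \<i> * of_real (l j)) \<alpha>) at_top"
      by (intro tendsto_intros filterlim_compose[OF tendsto_inverse_0] filterlim_of_real_at_infinity)
    also have "0 ^ (d - total \<alpha>) * mpow (\<lambda>j. \<i> * of_real (l j)) \<alpha> =
        (if total \<alpha> = d then mpow (\<lambda>j. \<i> * complex_of_real (l j)) \<alpha> else 0)"
      using that by auto
    finally show ?thesis
    proof (rule Lim_transform_eventually)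
      show "\<forall>\<^sub>F y in at_top. inverse (complex_of_real y) ^ (d - total \<alpha>) * mpow (\<lambda>j. \<i> * of_real (l j)) \<alpha> =
          mpow (z y) \<alpha> / of_real y ^ d"
        using eventually_gt_at_top[of 0]
      proof eventually_elim
        case (elim y)
        have "mpow (z y) \<alpha> = of_real y ^ total \<alpha> * mpow (\<lambda>j. \<i> * of_real (l j)) \<alpha>"
          using mpow_scale[of "of_real y" "\<lambda>j. \<i> * of_real (l j)" \<alpha>] by (simp add: z_def[abs_def] mult_ac)
        moreover have "complex_of_real y ^ d = of_real y ^ total \<alpha> * of_real y ^ (d - total \<alpha>)"
          using that by (simp flip: power_add)
        ultimately show ?case using elim by (simp add: power_inverse field_simps)
      qed
    qed
  qed
  have "((\<lambda>y. \<Sum>(\<alpha>, \<beta>)\<in>Poly_Mapping.keys a. of_real (Poly_Mapping.lookup a (\<alpha>, \<beta>)) * (mpow (z y) \<alpha> / of_real y ^ d) *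
      (\<Prod>j\<in>UNIV. poly (twist (s j) (Poly_Mapping.lookup \<beta> j) (h j)) (z y j) / poly (h j) (z y j))) \<longlongrightarrow>
    (\<Sum>(\<alpha>, \<beta>)\<in>Poly_Mapping.keys a. of_real (Poly_Mapping.lookup a (\<alpha>, \<beta>)) *
      (if total \<alpha> = d then mpow (\<lambda>j. \<i> * of_real (l j)) \<alpha> else 0) *
      (\<Prod>j\<in>UNIV. s j ^ Poly_Mapping.lookup \<beta> j))) at_top"
    unfolding case_prod_unfold
    by (intro tendsto_sum tendsto_mult tendsto_const tendsto_prod ratio mono) (auto intro: d)
  also have "(\<lambda>y. \<Sum>(\<alpha>, \<beta>)\<in>Poly_Mapping.keys a. of_real (Poly_Mapping.lookup a (\<alpha>, \<beta>)) * (mpow (z y) \<alpha> / of_real y ^ d) *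
      (\<Prod>j\<in>UNIV. poly (twist (s j) (Poly_Mapping.lookup \<beta> j) (h j)) (z y j) / poly (h j) (z y j))) =
    (\<lambda>y. shifted_op a s h (z y) / (of_real y ^ d * (\<Prod>j\<in>UNIV. poly (h j) (z y j))))"
    unfolding shifted_op_def prod_dividef sum_divide_distrib by (simp add: case_prod_unfold)
  also have "(\<Sum>(\<alpha>, \<beta>)\<in>Poly_Mapping.keys a. of_real (Poly_Mapping.lookup a (\<alpha>, \<beta>)) *
      (if total \<alpha> = d then mpow (\<lambda>j. \<i> * of_real (l j)) \<alpha> else 0) *
      (\<Prod>j\<in>UNIV. s j ^ Poly_Mapping.lookup \<beta> j)) =
    (\<Sum>(\<alpha>, \<beta>)\<in>Poly_Mapping.keys a. if total \<alpha> = d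
      then of_real (Poly_Mapping.lookup a (\<alpha>, \<beta>)) * mpow (\<lambda>j. \<i> * of_real (l j)) \<alpha> * mpow s \<beta> else 0)"
    unfolding mpow_def[of s] by (intro sum.cong refl) (simp split: prod.split)
  finally show ?thesis unfolding z_def .
qed

text \<open>With \<open>d\<close> the largest degree in z, the part of degree \<open>d\<close> of
  the symbol is a nonzero polynomial in the 2n quantities \<open>l\<close> and \<open>s\<close>. It
  cannot vanish at all positive points.\<close>

lemma exists_leading_direction:
  fixes a :: "('n::finite \<Rightarrow>\<^sub>0 nat) \<times> ('n \<Rightarrow>\<^sub>0 nat) \<Rightarrow>\<^sub>0 real"
  assumes "a \<noteq> 0"
  obtains l s :: "'n \<Rightarrow> real" and d where "\<And>j. l j > 0"
    "\<And>\<alpha> \<beta>. (\<alpha>, \<beta>) \<in> Poly_Mapping.keys a \<Longrightarrow> total \<alpha> \<le> d"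
    "(\<Sum>(\<alpha>, \<beta>)\<in>Poly_Mapping.keys a. if total \<alpha> = d
      then of_real (Poly_Mapping.lookup a (\<alpha>, \<beta>)) * mpow (\<lambda>j. \<i> * of_real (l j)) \<alpha> *
        mpow (\<lambda>j. of_real (s j)) \<beta> else 0) \<noteq> (0 :: complex)"
proof -
  note found = that
  let ?K = "Poly_Mapping.keys a"
  define d where "d = Max ((\<lambda>i. total (fst i)) ` ?K)"
  have ne: "?K \<noteq> {}" using assms by simp
  have le: "total \<alpha> \<le> d" if "(\<alpha>, \<beta>) \<in> ?K" for \<alpha> \<beta>
    unfolding d_def by (intro Max_ge finite_imageI finite_keys image_eqI[OF _ that]) simp
  have "d \<in> (\<lambda>i. total (fst i)) ` ?K"
    unfolding d_def using ne by (intro Max_in) auto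
  then obtain i0 where i0: "i0 \<in> ?K" "total (fst i0) = d" by (metis imageE)
  define S where "S = {i \<in> ?K. total (fst i) = d}"
  \<comment> \<open>Packs a pair of exponents into one exponent vector in 2n variables, so that
    \<open>sum_monomials_eq_0_imp\<close> applies.\<close>
  define join where "join i = (Poly_Mapping.Abs_poly_mapping (case_sum (Poly_Mapping.lookup (fst i)) (Poly_Mapping.lookup (snd i))) :: ('n + 'n) \<Rightarrow>\<^sub>0 nat)"
    for i :: "('n \<Rightarrow>\<^sub>0 nat) \<times> ('n \<Rightarrow>\<^sub>0 nat)"
  have join: "Poly_Mapping.lookup (join i) = case_sum (Poly_Mapping.lookup (fst i)) (Poly_Mapping.lookup (snd i))" for i
    by (simp add: join_def)
  have inj: "inj join"
  proof (rule injI)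
    fix i k assume "join i = join k"
    then have "Poly_Mapping.lookup (join i) v = Poly_Mapping.lookup (join k) v" for v by simp
    from this[of "Inl _"] this[of "Inr _"]
    have "Poly_Mapping.lookup (fst i) = Poly_Mapping.lookup (fst k)"
      "Poly_Mapping.lookup (snd i) = Poly_Mapping.lookup (snd k)"
      by (simp_all add: join fun_eq_iff)
    then show "i = k" by (simp only: Poly_Mapping.lookup_inject prod_eqI)
  qed
  have mpow_join: "mpow x (join i) = mpow (\<lambda>j. x (Inl j)) (fst i) * mpow (\<lambda>j. x (Inr j)) (snd i)"
    for x :: "'n + 'n \<Rightarrow> complex" and i
    unfolding mpow_def join UNIV_Plus_UNIV[symmetric] by (subst prod.Plus) auto
  show ?thesis
  proof (rule ccontr)
    assume no: "\<not> thesis"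
    have "(\<Sum>\<gamma>\<in>join ` S. of_real (Poly_Mapping.lookup a (inv join \<gamma>)) * mpow x \<gamma>) = 0"
      if x: "\<And>v. x v \<in> complex_of_real ` {0<..}" for x
    proof -
      define r where "r v = Re (x v)" for v
      have r: "x v = of_real (r v)" "r v > 0" for v using x[of v] by (auto simp: r_def)
      let ?f = "\<lambda>(\<alpha>, \<beta>). if total \<alpha> = d
        then of_real (Poly_Mapping.lookup a (\<alpha>, \<beta>)) * mpow (\<lambda>j. \<i> * of_real (r (Inl j))) \<alpha> *
          mpow (\<lambda>j. of_real (r (Inr j))) \<beta> else (0 :: complex)"
      have "0 = (\<Sum>i\<in>?K. ?f i)"
      proof (rule ccontr)
        assume nz: "0 \<noteq> (\<Sum>i\<in>?K. ?f i)"
        have thesis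
          by (rule found[of "\<lambda>j. r (Inl j)" d "\<lambda>j. r (Inr j)", OF _ _ nz[symmetric]])
            (fact r(2), erule le)
        with no show False by blast
      qed
      also have "(\<Sum>i\<in>?K. ?f i) = (\<Sum>i\<in>S. ?f i)"
        unfolding S_def by (rule sum.mono_neutral_right) (auto split: if_splits)
      \<comment> \<open>All remaining terms have degree exactly \<open>d\<close> in z, so the
        imaginary units combine to one common nonzero factor.\<close>
      also have "\<dots> = (\<Sum>i\<in>S. \<i> ^ d * (of_real (Poly_Mapping.lookup a i) * mpow x (join i)))"
      proof (intro sum.cong refl)
        fix i assume "i \<in> S"
        then show "?f i = \<i> ^ d * (of_real (Poly_Mapping.lookup a i) * mpow x (join i))"
          by (simp add: S_def case_prod_unfold mpow_scale mpow_join r(1)[symmetric])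
      qed
      also have "\<dots> = \<i> ^ d * (\<Sum>i\<in>S. of_real (Poly_Mapping.lookup a i) * mpow x (join i))"
        by (simp add: sum_distrib_left)
      finally have "(\<Sum>i\<in>S. of_real (Poly_Mapping.lookup a i) * mpow x (join i)) = 0" by simp
      then show ?thesis
        by (subst sum.reindex[OF inj_on_subset[OF inj subset_UNIV]]) (simp add: inv_f_f[OF inj])
    qed
    moreover have "infinite (complex_of_real ` {0<..})"
      using infinite_Ioi[of "0::real"] by (subst finite_image_iff) (simp_all add: inj_on_def)
    moreover have "finite (join ` S)" by (simp add: S_def)
    moreover have "join i0 \<in> join ` S" by (rule imageI) (use i0 in \<open>simp add: S_def\<close>)
    ultimately have "complex_of_real (Poly_Mapping.lookup a (inv join (join i0))) = 0"
      using sum_monomials_eq_0_imp[of "complex_of_real ` {0<..}" "join ` S"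
          "\<lambda>\<gamma>. of_real (Poly_Mapping.lookup a (inv join \<gamma>))" "join i0"] by blast
    then show False using i0 inj by (simp add: inv_f_f in_keys_iff)
  qed
qed

section \<open>Derivatives of (1 + u z / N)^N\<close>

text \<open>
  The factor that remains of the \<open>k\<close>-th derivative of \<open>(1 + u z / N)\<^sup>N g(z)\<close> when \<open>(1 + u z / N)\<^bsup>N - B\<^esup>\<close>
  is split off, where \<open>c i\<close> is the \<open>i\<close>-th derivative of \<open>g\<close>.
\<close>

definition quot_deriv :: "nat \<Rightarrow> nat \<Rightarrow> nat \<Rightarrow> (nat \<Rightarrow> complex) \<Rightarrow> complex \<Rightarrow> complex \<Rightarrow> complex" where
  "quot_deriv N B k c u z = (\<Sum>i\<le>k. of_nat (k choose i) *
     (of_nat (fact (k - i) * (N choose (k - i))) / of_nat N ^ (k - i)) * c i *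
     (u ^ (k - i) * (1 + inverse (of_nat N) * (u * z)) ^ (B - (k - i))))"

lemma poly_seq_uminus: "poly_seq F \<Longrightarrow> poly_seq (\<lambda>N z. - F N z)"
  using poly_seq_mult[OF poly_seq_const[of "\<lambda>_. - 1"], of F] by simp

text \<open>Used in two ways: if \<open>c i\<close> is the \<open>i\<close>-th derivative of g, the
  limit is the \<open>k\<close>-th power of (d/dz + u) applied to g; if \<open>c i = s ^ i\<close>,
  it is (s + u)^k.\<close>

lemma quot_deriv_limit:
  "(\<lambda>N. quot_deriv N B k c u z) \<longlonglongrightarrow> (\<Sum>i\<le>k. of_nat (k choose i) * c i * u ^ (k - i))"
proof -
  have "(\<lambda>N. quot_deriv N B k c u z) \<longlonglongrightarrow>
      (\<Sum>i\<le>k. of_nat (k choose i) * 1 * c i * (u ^ (k - i) * (1 + 0 * (u * z)) ^ (B - (k - i))))"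
    unfolding quot_deriv_def
    by (intro tendsto_sum tendsto_mult tendsto_const tendsto_power tendsto_add choose_over_power_limit lim_inverse_n)
  then show ?thesis by simp
qed

text \<open>The same power \<open>N - B\<close> splits off for all orders up to \<open>B\<close>, so
  it becomes a common factor of a whole operator, and the remaining exponent \<open>B - k\<close>
  does not involve \<open>N\<close>.\<close>

lemma poly_higher_pderiv_linear_power:
  fixes u z :: complex
  assumes "k \<le> B" "B \<le> N"
  shows "poly ((pderiv ^^ k) ([:1, u / of_nat N:] ^ N)) z =
    (1 + inverse (of_nat N) * (u * z)) ^ (N - B) *
    (of_nat (fact k * (N choose k)) / of_nat N ^ k * (u ^ k * (1 + inverse (of_nat N) * (u * z)) ^ (B - k)))"
proof -
  have "N - k = (N - B) + (B - k)" using assms by simp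
  then have "(1 + inverse (of_nat N) * (u * z)) ^ (N - k) =
      (1 + inverse (of_nat N) * (u * z)) ^ (N - B) * (1 + inverse (of_nat N) * (u * z)) ^ (B - k)"
    by (simp only: power_add)
  moreover have "poly [:1, u / of_nat N:] z = 1 + inverse (of_nat N) * (u * z)"
    by (simp add: divide_inverse mult_ac)
  ultimately show ?thesis
    unfolding higher_pderiv_linear_power poly_smult poly_power by (simp add: power_divide)
qed

lemma higher_pderiv_times_linear_power:
  assumes "k \<le> B" "B \<le> N"
  shows "poly ((pderiv ^^ k) (h * [:1, u / of_nat N:] ^ N)) z =
    (1 + inverse (of_nat N) * (u * z)) ^ (N - B) * quot_deriv N B k (\<lambda>i. poly ((pderiv ^^ i) h) z) u z"
  unfolding higher_pderiv_mult poly_sum quot_deriv_def sum_distrib_left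
proof (intro sum.cong refl)
  fix i assume "i \<in> {..k}"
  then have "k - i \<le> B" using assms by simp
  from poly_higher_pderiv_linear_power[OF this assms(2), of u z]
  show "poly (of_nat (k choose i) * ((pderiv ^^ i) h * (pderiv ^^ (k - i)) ([:1, u / of_nat N:] ^ N))) z =
    (1 + inverse (of_nat N) * (u * z)) ^ (N - B) * (of_nat (k choose i) *
     (of_nat (fact (k - i) * (N choose (k - i))) / of_nat N ^ (k - i)) * poly ((pderiv ^^ i) h) z *
     (u ^ (k - i) * (1 + inverse (of_nat N) * (u * z)) ^ (B - (k - i))))"
    by (simp add: mult_ac del: of_nat_mult of_nat_fact)
qed

lemma twist_linear_power:
  assumes "k \<le> B" "B \<le> N"
  shows "poly (twist s k ([:1, u / of_nat N:] ^ N)) z =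
    (1 + inverse (of_nat N) * (u * z)) ^ (N - B) * quot_deriv N B k (\<lambda>i. s ^ i) u z"
proof -
  have "poly (twist s k ([:1, u / of_nat N:] ^ N)) z =
      (\<Sum>i\<le>k. of_nat (k choose i) * s ^ (k - i) * poly ((pderiv ^^ i) ([:1, u / of_nat N:] ^ N)) z)"
    by (simp add: twist_def poly_sum)
  also have "\<dots> = (\<Sum>i\<le>k. of_nat (k choose (k - i)) * s ^ (k - (k - i)) *
      poly ((pderiv ^^ (k - i)) ([:1, u / of_nat N:] ^ N)) z)"
    unfolding atMost_atLeast0 by (subst sum.atLeastAtMost_rev) simp
  also have "\<dots> = (1 + inverse (of_nat N) * (u * z)) ^ (N - B) * quot_deriv N B k (\<lambda>i. s ^ i) u z"
    unfolding quot_deriv_def sum_distrib_left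
  proof (intro sum.cong refl)
    fix i assume "i \<in> {..k}"
    then have i: "k - i \<le> B" "k - (k - i) = i" "k choose (k - i) = k choose i"
      using assms by (simp_all add: binomial_symmetric[symmetric])
    show "of_nat (k choose (k - i)) * s ^ (k - (k - i)) *
      poly ((pderiv ^^ (k - i)) ([:1, u / of_nat N:] ^ N)) z =
    (1 + inverse (of_nat N) * (u * z)) ^ (N - B) * (of_nat (k choose i) *
     (of_nat (fact (k - i) * (N choose (k - i))) / of_nat N ^ (k - i)) * s ^ i *
     (u ^ (k - i) * (1 + inverse (of_nat N) * (u * z)) ^ (B - (k - i))))"
      unfolding poly_higher_pderiv_linear_power[OF i(1) assms(2)] i(2,3)
      by (simp add: mult_ac del: of_nat_mult of_nat_fact)
  qed
  finally show ?thesis .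
qed

lemma poly_seq_quot_deriv:
  assumes "\<And>i. poly_seq (\<lambda>_ z. c z i)" "poly_seq (\<lambda>_. u)" "poly_seq (\<lambda>_. x)"
  shows "poly_seq (\<lambda>N z. quot_deriv N B k (c z) (u z) (x z))"
  unfolding quot_deriv_def
  by (intro poly_seq_sum poly_seq_mult poly_seq_power poly_seq_add assms) (rule poly_seq_const)+

section \<open>Univariate real stable polynomials\<close>

definition real_stable_poly :: "complex poly \<Rightarrow> bool" where
  "real_stable_poly p \<longleftrightarrow> (\<forall>i. coeff p i \<in> \<real>) \<and> (\<forall>x. Im x > 0 \<longrightarrow> poly p x \<noteq> 0)"

lemma real_stable_poly_nonzero: "real_stable_poly p \<Longrightarrow> p \<noteq> 0"
  by (auto simp: real_stable_poly_def dest: spec[of _ \<i>])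

lemma real_stable_poly_1: "real_stable_poly 1"
  by (auto simp: real_stable_poly_def one_pCons coeff_pCons split: nat.split)

lemma real_stable_poly_mult:
  assumes "real_stable_poly p" "real_stable_poly q"
  shows "real_stable_poly (p * q)"
  using assms by (auto simp: real_stable_poly_def coeff_mult)

lemma real_stable_poly_power: "real_stable_poly p \<Longrightarrow> real_stable_poly (p ^ k)"
  by (induction k) (auto intro: real_stable_poly_1 real_stable_poly_mult)

lemma real_stable_poly_linear:
  assumes "c \<in> \<real>" "d \<in> \<real>" "c \<noteq> 0 \<or> d \<noteq> 0"
  shows "real_stable_poly [:c, d:]"
proof -
  obtain c' d' where cd: "c = of_real c'" "d = of_real d'" using assms by (auto elim!: Reals_cases)
  have "c + x * d \<noteq> 0" if "Im x > 0" for x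
  proof
    assume 0: "c + x * d = 0"
    then have "Im (c + x * d) = 0" by simp
    then have "d' = 0" using that by (simp add: cd)
    with 0 assms(3) show False by (simp add: cd)
  qed
  then show ?thesis
    using assms(1,2) by (auto simp: real_stable_poly_def coeff_pCons split: nat.split)
qed

lemma uprod_real_stable:
  assumes "\<And>j. real_stable_poly (q j)"
  shows "uprod q \<in> real_stable"
  using assms unfolding real_stable_iff real_coeffs_def
  by (auto simp: meval_uprod lookup_uprod real_stable_poly_def upper_def)

text \<open>
  The last assumption says that the coefficient of \<open>y\<^sup>d\<close> in \<open>F(\<i> y l, s)\<close>, a polynomial in \<open>y\<close> of
  degree at most \<open>d\<close>, does not vanish.
\<close>

locale preserver =
  fixes a :: "('n::finite \<Rightarrow>\<^sub>0 nat) \<times> ('n \<Rightarrow>\<^sub>0 nat) \<Rightarrow>\<^sub>0 real"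
    and l :: "'n \<Rightarrow> real" and s :: "'n \<Rightarrow> complex" and d :: nat
  assumes pres: "f \<in> real_stable \<Longrightarrow> weyl_op a f \<in> real_stable \<union> {0}"
    and l_pos: "l j > 0"
    and s_real: "s j \<in> \<real>"
    and total_le: "(\<alpha>, \<beta>) \<in> Poly_Mapping.keys a \<Longrightarrow> total \<alpha> \<le> d"
    and leading: "(\<Sum>(\<alpha>, \<beta>)\<in>Poly_Mapping.keys a. if total \<alpha> = d
      then of_real (Poly_Mapping.lookup a (\<alpha>, \<beta>)) * mpow (\<lambda>j. \<i> * of_real (l j)) \<alpha> * mpow s \<beta>
      else 0) \<noteq> (0 :: complex)"
begin

abbreviation ray :: "real \<Rightarrow> 'n \<Rightarrow> complex" where
  "ray y \<equiv> \<lambda>j. \<i> * of_real (y * l j)"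

lemma ray_upper: "y > 0 \<Longrightarrow> ray y \<in> upper"
  using l_pos by (simp add: upper_def)

definition order_bound :: nat where
  "order_bound = (\<Sum>i\<in>Poly_Mapping.keys a. total (snd i))"

lemma lookup_le_order_bound:
  assumes "(\<alpha>, \<beta>) \<in> Poly_Mapping.keys a"
  shows "Poly_Mapping.lookup \<beta> j \<le> order_bound"
proof -
  have "Poly_Mapping.lookup \<beta> j \<le> total \<beta>"
    unfolding total_def by (rule member_le_sum) auto
  also have "total \<beta> \<le> order_bound"
    unfolding order_bound_def
    using member_le_sum[of "(\<alpha>, \<beta>)" "Poly_Mapping.keys a" "\<lambda>i. total (snd i)"] assms by simp
  finally show ?thesis .
qed

definition lead :: complex where
  "lead = (\<Sum>(\<alpha>, \<beta>)\<in>Poly_Mapping.keys a. if total \<alpha> = d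
    then of_real (Poly_Mapping.lookup a (\<alpha>, \<beta>)) * mpow (\<lambda>j. \<i> * of_real (l j)) \<alpha> * mpow s \<beta> else 0)"

lemma lead_nonzero: "lead \<noteq> 0"
  unfolding lead_def by (rule leading)

lemma ratio_limit:
  assumes "\<And>j. h j \<noteq> 0"
  shows "((\<lambda>y. shifted_op a s h (ray y) /
      (of_real y ^ d * (\<Prod>j\<in>UNIV. poly (h j) (ray y j)))) \<longlongrightarrow> lead) at_top"
  unfolding lead_def by (rule shifted_op_asymptotic[OF l_pos assms total_le])

section \<open>Polynomial approximation of exp(s z) h\<close>

lemma shifted_op_nonzero_on_ray:
  assumes h: "\<And>j. h j \<noteq> 0"
  shows "\<forall>\<^sub>F y in at_top. shifted_op a s h (ray y) \<noteq> 0"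
proof -
  from tendsto_imp_eventually_ne[OF ratio_limit[OF h] lead_nonzero] show ?thesis
    by eventually_elim auto
qed

text \<open>Polynomial substitute for exp(s z) h(z). The added linear factors are real because
  \<open>s\<close> is, so real stability of the \<open>h j\<close> is kept.\<close>

definition approx :: "('n \<Rightarrow> complex poly) \<Rightarrow> nat \<Rightarrow> ('n, complex) mpoly" where
  "approx h N = uprod (\<lambda>j. h j * [:1, s j / of_nat N:] ^ N)"

text \<open>What is left of T applied to \<open>approx h N\<close> after the common linear powers
  are removed. Written without division, it has degree bounded independently of \<open>N\<close>, as
  Hurwitz requires.\<close>

definition approx_quot :: "('n \<Rightarrow> complex poly) \<Rightarrow> nat \<Rightarrow> ('n \<Rightarrow> complex) \<Rightarrow> complex" where
  "approx_quot h N z = (\<Sum>(\<alpha>, \<beta>)\<in>Poly_Mapping.keys a. of_real (Poly_Mapping.lookup a (\<alpha>, \<beta>)) * mpow z \<alpha> *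
     (\<Prod>j\<in>UNIV. quot_deriv N order_bound (Poly_Mapping.lookup \<beta> j)
       (\<lambda>i. poly ((pderiv ^^ i) (h j)) (z j)) (s j) (z j)))"

lemma meval_weyl_op_approx:
  assumes "N \<ge> order_bound"
  shows "meval z (weyl_op a (approx h N)) =
    (\<Prod>j\<in>UNIV. (1 + inverse (of_nat N) * (s j * z j)) ^ (N - order_bound)) * approx_quot h N z"
  unfolding approx_def meval_weyl_op_uprod approx_quot_def sum_distrib_left
proof (intro sum.cong refl)
  let ?B = order_bound
  fix i assume i: "i \<in> Poly_Mapping.keys a"
  obtain \<alpha> \<beta> where ab: "i = (\<alpha>, \<beta>)" by (cases i)
  have "poly ((pderiv ^^ Poly_Mapping.lookup \<beta> j) (h j * [:1, s j / of_nat N:] ^ N)) (z j) =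
    (1 + inverse (of_nat N) * (s j * z j)) ^ (N - ?B) *
    quot_deriv N ?B (Poly_Mapping.lookup \<beta> j) (\<lambda>i. poly ((pderiv ^^ i) (h j)) (z j)) (s j) (z j)" for j
    by (rule higher_pderiv_times_linear_power) (use lookup_le_order_bound[of \<alpha> \<beta>] i ab assms in auto)
  then show "(case i of (\<alpha>, \<beta>) \<Rightarrow> of_real (Poly_Mapping.lookup a (\<alpha>, \<beta>)) * mpow z \<alpha> *
      (\<Prod>j\<in>UNIV. poly ((pderiv ^^ Poly_Mapping.lookup \<beta> j) (h j * [:1, s j / of_nat N:] ^ N)) (z j))) =
    (\<Prod>j\<in>UNIV. (1 + inverse (of_nat N) * (s j * z j)) ^ (N - ?B)) *
    (case i of (\<alpha>, \<beta>) \<Rightarrow> of_real (Poly_Mapping.lookup a (\<alpha>, \<beta>)) * mpow z \<alpha> *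
      (\<Prod>j\<in>UNIV. quot_deriv N ?B (Poly_Mapping.lookup \<beta> j) (\<lambda>i. poly ((pderiv ^^ i) (h j)) (z j)) (s j) (z j)))"
    by (simp only: ab prod.case prod.distrib mult_ac)
qed

lemma approx_quot_limit: "(\<lambda>N. approx_quot h N z) \<longlonglongrightarrow> shifted_op a s h z"
proof -
  have "(\<lambda>N. approx_quot h N z) \<longlonglongrightarrow>
    (\<Sum>(\<alpha>, \<beta>)\<in>Poly_Mapping.keys a. of_real (Poly_Mapping.lookup a (\<alpha>, \<beta>)) * mpow z \<alpha> *
    (\<Prod>j\<in>UNIV. (\<Sum>i\<le>Poly_Mapping.lookup \<beta> j. of_nat (Poly_Mapping.lookup \<beta> j choose i) *
      poly ((pderiv ^^ i) (h j)) (z j) * s j ^ (Poly_Mapping.lookup \<beta> j - i))))"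
    unfolding approx_quot_def case_prod_unfold
    by (intro tendsto_sum tendsto_mult tendsto_const tendsto_prod quot_deriv_limit)
  then show ?thesis
    by (simp add: shifted_op_def twist_def poly_sum mult_ac)
qed

text \<open>Excludes the alternative 0 in the assumption \<open>pres\<close>: the quotient tends to
  a nonzero value at a suitable point of the ray, and the removed real linear factors do not vanish
  there.\<close>

lemma weyl_op_approx_nonzero:
  assumes h: "\<And>j. h j \<noteq> 0"
  obtains y where "y > 0" "shifted_op a s h (ray y) \<noteq> 0"
    "\<forall>\<^sub>F N in sequentially. meval (ray y) (weyl_op a (approx h N)) \<noteq> 0"
proof -
  have "\<forall>\<^sub>F y in at_top. y > 0 \<and> shifted_op a s h (ray y) \<noteq> 0"
    by (intro eventually_conj eventually_gt_at_top shifted_op_nonzero_on_ray h)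
  then obtain y where y: "y > 0" "shifted_op a s h (ray y) \<noteq> 0"
    using eventually_happens'[OF trivial_limit_at_top_linorder] by blast
  have "\<forall>\<^sub>F N in sequentially. approx_quot h N (ray y) \<noteq> 0"
    by (rule tendsto_imp_eventually_ne[OF approx_quot_limit y(2)])
  then have "\<forall>\<^sub>F N in sequentially. meval (ray y) (weyl_op a (approx h N)) \<noteq> 0"
    using eventually_ge_at_top[of order_bound]
  proof eventually_elim
    case (elim N)
    have "1 + inverse (of_nat N) * (s j * ray y j) \<noteq> 0" for j
    proof -
      have "real_stable_poly [:1, s j / of_nat N:]"
        using s_real by (intro real_stable_poly_linear) (auto intro: Reals_divide)
      then have "poly [:1, s j / of_nat N:] (ray y j) \<noteq> 0"
        using ray_upper[OF y(1)] unfolding real_stable_poly_def upper_def by blast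
      then show ?thesis by (simp add: divide_inverse mult_ac)
    qed
    then show ?case using elim by (simp add: meval_weyl_op_approx)
  qed
  with y show ?thesis by (rule that)
qed

text \<open>For large \<open>N\<close> the image of \<open>approx h N\<close> is real stable and
  nonzero, so its quotient is zero-free in \<open>upper\<close>. A zero of the limit would spread to
  the ray, where the limit is known not to vanish.\<close>

lemma shifted_op_nonzero_real:
  assumes h: "\<And>j. real_stable_poly (h j)" and z: "z \<in> upper"
  shows "shifted_op a s h z \<noteq> 0"
proof
  assume zero: "shifted_op a s h z = 0"
  have nz: "h j \<noteq> 0" for j by (rule real_stable_poly_nonzero[OF h])
  have f: "approx h N \<in> real_stable" for N
    unfolding approx_def using s_real
    by (intro uprod_real_stable real_stable_poly_mult real_stable_poly_power real_stable_poly_linear h)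
      (auto intro!: Reals_divide)
  obtain y where y: "y > 0" "shifted_op a s h (ray y) \<noteq> 0"
    "\<forall>\<^sub>F N in sequentially. meval (ray y) (weyl_op a (approx h N)) \<noteq> 0"
    by (rule weyl_op_approx_nonzero[OF nz])
  have "\<forall>\<^sub>F N in sequentially. \<forall>x\<in>upper. approx_quot h N x \<noteq> 0"
    using y(3) eventually_ge_at_top[of order_bound]
  proof eventually_elim
    case (elim N)
    then have "weyl_op a (approx h N) \<in> real_stable" using pres[OF f, of N] by auto
    then show ?case using elim by (auto simp: real_stable_iff meval_weyl_op_approx)
  qed
  moreover have "poly_seq (approx_quot h)"
    unfolding approx_quot_def case_prod_unfold
    by (intro poly_seq_sum poly_seq_mult poly_seq_const poly_seq_mpow poly_seq_prod poly_seq_quot_deriv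
        poly_seq_poly poly_seq_coord)
  ultimately have "shifted_op a s h (ray y) = 0"
    by (intro Hurwitz_upper[OF _ poly_seq_shifted_op _ approx_quot_limit z zero])
  with y show False by simp
qed

text \<open>
  Adding a linear factor with root \<open>\<xi>\<close> in variable \<open>j\<close> gives \<open>A - \<xi> B\<close>. The ratio \<open>A / B\<close> is not
  real on the product of upper half-planes because the statement holds for real \<open>\<xi>\<close>, and its
  imaginary part is positive far out on the ray.
\<close>

lemma shifted_op_linear_factor_nonzero:
  assumes g: "\<And>j. g j \<noteq> 0"
    and B: "\<And>z. z \<in> upper \<Longrightarrow> shifted_op a s g z \<noteq> 0"
    and real: "\<And>z \<xi>. z \<in> upper \<Longrightarrow> \<xi> \<in> \<real> \<Longrightarrow> shifted_op a s (g(j := [:-\<xi>, 1:] * g j)) z \<noteq> 0"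
    and w: "Im w > 0" and z: "z \<in> upper"
  shows "shifted_op a s (g(j := [:1, -w:] * g j)) z \<noteq> 0"
proof -
  let ?B = "shifted_op a s g" and ?A = "shifted_op a s (g(j := [:0, 1:] * g j))"
  have lin: "shifted_op a s (g(j := [:c, e:] * g j)) x = c * ?B x + e * ?A x" for c e x
    using shifted_op_linear[of a s g j c "g j" e "[:0, 1:] * g j" x] by simp
  define \<rho> where "\<rho> x = ?A x / ?B x" for x
  have nonreal: "Im (\<rho> x) \<noteq> 0" if x: "x \<in> upper" for x
  proof
    assume "Im (\<rho> x) = 0"
    then have "\<rho> x \<in> \<real>" by (simp add: complex_is_Real_iff)
    \<comment> \<open>With \<open>\<xi>\<close> = \<open>\<rho> x\<close> the combination A -
      \<open>\<xi>\<close> B vanishes at x.\<close>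
    from real[OF x this] show False
      using B[OF x] unfolding lin[of "- \<rho> x" 1 x] by (simp add: \<rho>_def)
  qed
  obtain y where y: "y > 0" "Im (\<rho> (ray y)) > 0"
  proof -
    have g': "(g(j := [:0, 1:] * g j)) i \<noteq> 0" for i using g by auto
    have prod: "(\<Prod>i\<in>UNIV. poly ((g(j := [:0, 1:] * g j)) i) (x i)) = x j * (\<Prod>i\<in>UNIV. poly (g i) (x i))" for x
    proof -
      have "(\<Prod>i\<in>UNIV-{j}. poly ((g(j := [:0, 1:] * g j)) i) (x i)) = (\<Prod>i\<in>UNIV-{j}. poly (g i) (x i))"
        by (rule prod.cong) auto
      then show ?thesis
        by (simp add: prod.remove[of UNIV j] mult_ac)
    qed
    \<comment> \<open>Both normalised quantities tend to \<open>lead\<close>; the normalisation of A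
      has the extra factor \<open>ray y j\<close>. Hence \<open>\<rho>\<close> on the ray is
      \<open>ray y j\<close> times a quantity tending to 1, that is, close in direction to the
      positive imaginary axis.\<close>
    define a1 where "a1 y = ?A (ray y) / (of_real y ^ d * (ray y j * (\<Prod>i\<in>UNIV. poly (g i) (ray y i))))" for y
    define b1 where "b1 y = ?B (ray y) / (of_real y ^ d * (\<Prod>i\<in>UNIV. poly (g i) (ray y i)))" for y
    have a1: "(a1 \<longlongrightarrow> lead) at_top" using ratio_limit[of "g(j := [:0, 1:] * g j)", OF g'] unfolding prod a1_def .
    have b1: "(b1 \<longlongrightarrow> lead) at_top" using ratio_limit[of g, OF g] unfolding b1_def .
    have "((\<lambda>y. Re (a1 y / b1 y)) \<longlongrightarrow> Re (lead / lead)) at_top"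
      by (intro tendsto_intros a1 b1 lead_nonzero)
    then have "\<forall>\<^sub>F y in at_top. Re (a1 y / b1 y) > 0"
      using lead_nonzero by (intro order_tendstoD(1)) auto
    moreover have "\<forall>\<^sub>F y in at_top. b1 y \<noteq> 0" by (rule tendsto_imp_eventually_ne[OF b1 lead_nonzero])
    ultimately have "\<forall>\<^sub>F y in at_top. y > 0 \<and> Im (\<rho> (ray y)) > 0"
      using eventually_gt_at_top[of 0]
    proof eventually_elim
      case (elim y)
      have *: "A / B = x * ((A / (P * (x * Q))) / (B / (P * Q)))"
        if "P \<noteq> 0" "Q \<noteq> 0" "x \<noteq> 0" for A B P Q x :: complex
        using that by (cases "B = 0") (simp_all add: field_simps)
      have "ray y j \<noteq> 0" using elim l_pos[of j] by simp
      moreover have "of_real y ^ d \<noteq> (0::complex)" "(\<Prod>i\<in>UNIV. poly (g i) (ray y i)) \<noteq> 0"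
        using elim(2) unfolding b1_def by (metis div_by_0 mult_zero_left mult_zero_right)+
      ultimately have eq: "\<rho> (ray y) = ray y j * (a1 y / b1 y)"
        unfolding \<rho>_def a1_def b1_def by (intro *)
      have **: "Im (\<i> * of_real c * v) = c * Re v" for c v by simp
      have "Im (\<rho> (ray y)) = y * l j * Re (a1 y / b1 y)" unfolding eq ** ..
      with elim l_pos[of j] show ?case by simp
    qed
    from eventually_happens'[OF trivial_limit_at_top_linorder this] that show thesis by blast
  qed
  have pos: "Im (\<rho> z) > 0"
  proof (rule ccontr)
    assume "\<not> Im (\<rho> z) > 0"
    \<comment> \<open>The segment from the ray to \<open>z\<close> stays in \<open>upper\<close> by
      convexity; if Im(\<open>\<rho> z\<close>) <= 0, the intermediate value theorem yields a real
      value of \<open>\<rho>\<close> on it.\<close>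
    define L where "L t = (\<lambda>i. ray y i + complex_of_real t * (z i - ray y i))" for t
    have up: "L t \<in> upper" if "0 \<le> t" "t \<le> 1" for t
    proof -
      have "Im (L t i) = (1 - t) * Im (ray y i) + t * Im (z i)" for i
        by (simp add: L_def algebra_simps)
      moreover have "(1 - t) * Im (ray y i) + t * Im (z i) > 0" for i
      proof -
        have "Im (ray y i) > 0" "Im (z i) > 0"
          using ray_upper[OF y(1)] z unfolding upper_def by blast+
        with that show ?thesis
          by (cases "t = 1") (auto intro!: add_pos_nonneg mult_pos_pos simp del: Im_i_times)
      qed
      ultimately show ?thesis by (simp add: upper_def)
    qed
    have on_line: "\<exists>p. \<forall>t. shifted_op a s h (L t) = poly p (of_real t)" for h
    proof -
      obtain D where "\<forall>N z l. \<exists>p. Polynomial.degree p \<le> D \<and>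
          (\<forall>t. shifted_op a s h (\<lambda>i. z i + t * l i) = poly p t)"
        using poly_seq_shifted_op[of a s h] unfolding poly_seq_def by blast
      from this[rule_format, of "ray y" "\<lambda>i. z i - ray y i"] show ?thesis
        unfolding L_def by metis
    qed
    obtain p where p: "\<And>t. ?A (L t) = poly p (of_real t)" using on_line by blast
    obtain q where q: "\<And>t. ?B (L t) = poly q (of_real t)" using on_line by blast
    have "continuous_on {0..1} (\<lambda>t. Im (\<rho> (L t)))"
      unfolding \<rho>_def p q
    proof (intro continuous_intros ballI)
      fix t :: real assume "t \<in> {0..1}"
      then show "poly q (of_real t) \<noteq> 0" using B[OF up] q by (metis atLeastAtMost_iff)
    qed
    then have "\<exists>t. 0 \<le> t \<and> t \<le> 1 \<and> Im (\<rho> (L t)) = 0"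
      using y(2) \<open>\<not> Im (\<rho> z) > 0\<close> by (intro IVT2') (auto simp: L_def)
    then show False using nonreal up by blast
  qed
  show ?thesis
  proof
    assume "shifted_op a s (g(j := [:1, -w:] * g j)) z = 0"
    \<comment> \<open>The polynomial with factor 1 - w z_j gives B - w A, so a zero means that
      \<open>\<rho> z\<close> is 1/w, a point of the lower half-plane.\<close>
    then have "w * \<rho> z = 1"
      using B[OF z] unfolding lin[of 1 "- w" z] by (simp add: \<rho>_def field_simps)
    then have "\<rho> z = 1 / w" by (metis nonzero_eq_divide_eq mult.commute mult_zero_left zero_neq_one)
    moreover have "Im (1 / w) < 0"
      using w by (simp add: Im_divide divide_less_0_iff) (simp add: add_nonneg_pos)
    ultimately show False using pos by simp
  qed
qed

section \<open>Products with roots in the lower half-plane\<close>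

definition admissible :: "('n \<Rightarrow> complex poly) \<Rightarrow> bool" where
  "admissible r \<longleftrightarrow> (\<forall>j. r j \<noteq> 0) \<and>
     (\<forall>h z. (\<forall>j. real_stable_poly (h j)) \<longrightarrow> z \<in> upper \<longrightarrow> shifted_op a s (\<lambda>j. h j * r j) z \<noteq> 0)"

lemma admissibleD:
  "admissible r \<Longrightarrow> (\<And>j. real_stable_poly (h j)) \<Longrightarrow> z \<in> upper \<Longrightarrow>
    shifted_op a s (\<lambda>j. h j * r j) z \<noteq> 0"
  by (simp add: admissible_def)

lemma admissible_1: "admissible (\<lambda>_. 1)"
  using shifted_op_nonzero_real by (simp add: admissible_def)

text \<open>To verify the condition for real roots, the factor with root \<open>\<xi>\<close> is
  absorbed into \<open>h\<close>; this is why \<open>admissible\<close> quantifies over all real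
  stable \<open>h\<close>.\<close>

lemma admissible_linear_factor:
  assumes r: "admissible r" and w: "Im w > 0"
  shows "admissible (r(j := [:1, -w:] * r j))"
proof -
  have "shifted_op a s (\<lambda>i. h i * (r(j := [:1, -w:] * r j)) i) z \<noteq> 0"
    if h: "\<And>i. real_stable_poly (h i)" and z: "z \<in> upper" for h z
  proof -
    let ?g = "\<lambda>i. h i * r i"
    have "shifted_op a s (?g(j := [:1, -w:] * ?g j)) z \<noteq> 0"
    proof (rule shifted_op_linear_factor_nonzero[OF _ _ _ w z])
      show "?g i \<noteq> 0" for i
        using r real_stable_poly_nonzero[OF h] by (simp add: admissible_def)
      show "shifted_op a s ?g x \<noteq> 0" if "x \<in> upper" for x
        using r h that by (simp add: admissible_def)
      show "shifted_op a s (?g(j := [:-\<xi>, 1:] * ?g j)) x \<noteq> 0" if "x \<in> upper" "\<xi> \<in> \<real>" for x \<xi>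
      proof -
        have "real_stable_poly ((h(j := [:-\<xi>, 1:] * h j)) i)" for i
          using h that by (auto intro!: real_stable_poly_mult real_stable_poly_linear simp del: mult_pCons_left)
        then have "shifted_op a s (\<lambda>i. (h(j := [:-\<xi>, 1:] * h j)) i * r i) x \<noteq> 0"
          using r that unfolding admissible_def by blast
        also have "(\<lambda>i. (h(j := [:-\<xi>, 1:] * h j)) i * r i) = ?g(j := [:-\<xi>, 1:] * ?g j)"
          by (simp add: fun_eq_iff mult.assoc del: mult_pCons_left)
        finally show ?thesis .
      qed
    qed
    also have "?g(j := [:1, -w:] * ?g j) = (\<lambda>i. h i * (r(j := [:1, -w:] * r j)) i)"
      by (simp add: fun_eq_iff mult.left_commute del: mult_pCons_left)
    finally show ?thesis .
  qed
  then show ?thesis using r by (auto simp: admissible_def simp del: mult_pCons_left)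
qed

lemma admissible_linear_power:
  assumes r: "admissible r" and w: "Im w > 0"
  shows "admissible (r(j := [:1, -w:] ^ k * r j))"
proof (induction k)
  case 0
  then show ?case using r by simp
next
  case (Suc k)
  from admissible_linear_factor[OF this w, of j] show ?case
    by (simp only: fun_upd_upd fun_upd_same power_Suc mult.assoc)
qed

lemma admissible_linear_powers:
  assumes w: "\<And>j. Im (w j) > 0"
  shows "admissible (\<lambda>j. [:1, - w j:] ^ k)"
proof -
  have "admissible (\<lambda>j. if j \<in> K then [:1, - w j:] ^ k else 1)" if "finite K" for K
    using that
  proof (induction K rule: finite_induct)
    case empty
    then show ?case by (simp add: admissible_1)
  next
    case (insert i K)
    let ?r = "\<lambda>j. if j \<in> K then [:1, - w j:] ^ k else 1"
    have "(\<lambda>j. if j \<in> insert i K then [:1, - w j:] ^ k else 1) = ?r(i := [:1, - w i:] ^ k * ?r i)"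
      using insert.hyps by (auto simp: fun_eq_iff)
    then show ?case using admissible_linear_power[OF insert.IH w[of i], where j = i and k = k] by simp
  qed
  from this[of UNIV] show ?thesis by simp
qed

text \<open>The products of (1 - w_j z_j / N)^N approximate exp(-w z), on which the shifted operator
  acts as multiplication by F(z, s - w). After a common power is removed, Hurwitz in the 2n
  variables z and w passes to the limit.\<close>

lemma symb_shift_nonzero:
  assumes zw: "z \<in> upper" "w \<in> upper"
  shows "symb a z (\<lambda>j. s j - w j) \<noteq> 0"
proof
  assume zero: "symb a z (\<lambda>j. s j - w j) = 0"
  let ?B = order_bound
  define F where "F N x = (\<Sum>(\<alpha>, \<beta>)\<in>Poly_Mapping.keys a. of_real (Poly_Mapping.lookup a (\<alpha>, \<beta>)) *
     mpow (\<lambda>j. x (Inl j)) \<alpha> *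
     (\<Prod>j\<in>UNIV. quot_deriv N ?B (Poly_Mapping.lookup \<beta> j) (\<lambda>i. s j ^ i) (- x (Inr j)) (x (Inl j))))"
    for N and x :: "'n + 'n \<Rightarrow> complex"
  define S where "S x = symb a (\<lambda>j. x (Inl j)) (\<lambda>j. s j - x (Inr j))" for x
  have F_nz: "F N x \<noteq> 0" if N: "N \<ge> Suc ?B" and x: "x \<in> upper" for N x
  proof -
    let ?g = "\<lambda>j. [:1, - x (Inr j) / of_nat N:] ^ N"
    \<comment> \<open>The roots are N divided by a point of the upper half-plane, hence lie in the
      lower half-plane; N >= \<open>Suc ?B\<close> ensures N > 0.\<close>
    have "admissible (\<lambda>j. [:1, - (x (Inr j) / of_nat N):] ^ N)"
      using x N by (intro admissible_linear_powers) (auto simp: upper_def Im_divide_of_nat)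
    then have "admissible ?g" by simp
    then have "shifted_op a s (\<lambda>j. 1 * ?g j) (\<lambda>j. x (Inl j)) \<noteq> 0"
      by (rule admissibleD) (use x in \<open>auto simp: real_stable_poly_1 upper_def\<close>)
    also have "shifted_op a s (\<lambda>j. 1 * ?g j) (\<lambda>j. x (Inl j)) =
        (\<Prod>j\<in>UNIV. (1 + inverse (of_nat N) * (- x (Inr j) * x (Inl j))) ^ (N - ?B)) * F N x"
      unfolding shifted_op_def F_def sum_distrib_left
    proof (intro sum.cong refl)
      fix i assume i: "i \<in> Poly_Mapping.keys a"
      obtain \<alpha> \<beta> where ab: "i = (\<alpha>, \<beta>)" by (cases i)
      have "poly (twist (s j) (Poly_Mapping.lookup \<beta> j) (1 * ?g j)) (x (Inl j)) =
        (1 + inverse (of_nat N) * (- x (Inr j) * x (Inl j))) ^ (N - ?B) *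
        quot_deriv N ?B (Poly_Mapping.lookup \<beta> j) (\<lambda>i. s j ^ i) (- x (Inr j)) (x (Inl j))" for j
        unfolding mult_1 by (rule twist_linear_power) (use lookup_le_order_bound[of \<alpha> \<beta>] i ab N in auto)
      then show "(case i of (\<alpha>, \<beta>) \<Rightarrow> of_real (Poly_Mapping.lookup a (\<alpha>, \<beta>)) * mpow (\<lambda>j. x (Inl j)) \<alpha> *
          (\<Prod>j\<in>UNIV. poly (twist (s j) (Poly_Mapping.lookup \<beta> j) (1 * ?g j)) (x (Inl j)))) =
        (\<Prod>j\<in>UNIV. (1 + inverse (of_nat N) * (- x (Inr j) * x (Inl j))) ^ (N - ?B)) *
        (case i of (\<alpha>, \<beta>) \<Rightarrow> of_real (Poly_Mapping.lookup a (\<alpha>, \<beta>)) * mpow (\<lambda>j. x (Inl j)) \<alpha> *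
          (\<Prod>j\<in>UNIV. quot_deriv N ?B (Poly_Mapping.lookup \<beta> j) (\<lambda>i. s j ^ i) (- x (Inr j)) (x (Inl j))))"
        by (simp only: ab prod.case prod.distrib mult_ac)
    qed
    finally show ?thesis by simp
  qed
  have lim: "(\<lambda>N. F N x) \<longlonglongrightarrow> S x" for x
  proof -
    have "(\<lambda>N. F N x) \<longlonglongrightarrow> (\<Sum>(\<alpha>, \<beta>)\<in>Poly_Mapping.keys a. of_real (Poly_Mapping.lookup a (\<alpha>, \<beta>)) *
      mpow (\<lambda>j. x (Inl j)) \<alpha> *
      (\<Prod>j\<in>UNIV. (\<Sum>i\<le>Poly_Mapping.lookup \<beta> j. of_nat (Poly_Mapping.lookup \<beta> j choose i) *
        s j ^ i * (- x (Inr j)) ^ (Poly_Mapping.lookup \<beta> j - i))))"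
      unfolding F_def case_prod_unfold
      by (intro tendsto_sum tendsto_mult tendsto_const tendsto_prod quot_deriv_limit)
    then show ?thesis
      unfolding binomial_ring[symmetric] by (simp add: S_def symb_def mpow_def[of "\<lambda>j. s j - x (Inr j)"])
  qed
  have F: "poly_seq F"
    unfolding F_def case_prod_unfold mpow_def
    by (intro poly_seq_sum poly_seq_mult poly_seq_const poly_seq_prod poly_seq_quot_deriv
        poly_seq_power poly_seq_coord poly_seq_uminus)
  have S: "poly_seq (\<lambda>_. S)"
    unfolding S_def symb_def case_prod_unfold mpow_def diff_conv_add_uminus
    by (intro poly_seq_sum poly_seq_mult poly_seq_const poly_seq_prod poly_seq_add
        poly_seq_power poly_seq_coord poly_seq_uminus)
  obtain y where y: "shifted_op a s (\<lambda>_. 1) (ray y) \<noteq> 0"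
    using eventually_happens[OF shifted_op_nonzero_on_ray[of "\<lambda>_. 1"]] by auto
  have nz: "\<forall>\<^sub>F N in sequentially. \<forall>x\<in>upper. F N x \<noteq> 0"
    by (rule eventually_mono[OF eventually_ge_at_top[of "Suc ?B"]]) (intro ballI F_nz)
  have up: "case_sum z w \<in> upper"
    unfolding upper_def
  proof safe
    fix v show "Im (case_sum z w v) > 0" using zw by (cases v) (simp_all add: upper_def)
  qed
  have "S (case_sum z w) = 0" unfolding S_def by (simp only: sum.case zero)
  \<comment> \<open>The target point has w = 0 and so lies outside \<open>upper\<close>, which
    \<open>Hurwitz_upper\<close> permits. There \<open>S\<close> is the shifted operator applied to
    1, nonzero on the ray by the choice of \<open>y\<close>.\<close>
  then have "S (case_sum (ray y) (\<lambda>_. 0)) = 0" by (rule Hurwitz_upper[OF F S nz lim up])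
  then have "symb a (ray y) s = 0" unfolding S_def by simp
  with y show False unfolding shifted_op_1 by contradiction
qed

end

section \<open>The equivalence for operators\<close>

lemma symb_nonzero_if_preserver:
  assumes "preserver a l s d" "z \<in> upper" "w \<in> upper"
  shows "symb a z (\<lambda>j. - w j) \<noteq> 0"
proof -
  interpret preserver a l s d by fact
  have "Im (s j) = 0" for j using s_real[of j] by (simp add: complex_is_Real_iff)
  \<comment> \<open>The shift \<open>s\<close> is real, so replacing w by w + s keeps imaginary
    parts and undoes the conjugation by exp(s z).\<close>
  then have "(\<lambda>j. w j + s j) \<in> upper" using assms(3) by (simp add: upper_def)
  from symb_shift_nonzero[OF assms(2) this] show ?thesis by simp
qed

lemma preserver_exists:
  fixes a :: "('n::finite \<Rightarrow>\<^sub>0 nat) \<times> ('n \<Rightarrow>\<^sub>0 nat) \<Rightarrow>\<^sub>0 real"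
  assumes a: "a \<noteq> 0" and pres: "\<And>f. f \<in> real_stable \<Longrightarrow> weyl_op a f \<in> real_stable \<union> {0}"
  obtains l s d where "preserver a l s d"
proof (rule exists_leading_direction[OF a])
  fix l s :: "'n \<Rightarrow> real" and d
  assume ls: "\<And>j. l j > 0"
    "\<And>\<alpha> \<beta>. (\<alpha>, \<beta>) \<in> Poly_Mapping.keys a \<Longrightarrow> total \<alpha> \<le> d"
    "(\<Sum>(\<alpha>, \<beta>)\<in>Poly_Mapping.keys a. if total \<alpha> = d
      then of_real (Poly_Mapping.lookup a (\<alpha>, \<beta>)) * mpow (\<lambda>j. \<i> * of_real (l j)) \<alpha> *
        mpow (\<lambda>j. of_real (s j)) \<beta> else 0) \<noteq> (0 :: complex)"
  have "preserver a l (\<lambda>j. of_real (s j)) d"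
  proof
    show "weyl_op a f \<in> real_stable \<union> {0}" if "f \<in> real_stable" for f by (rule pres[OF that])
    show "0 < l j" for j by (rule ls(1))
    show "complex_of_real (s j) \<in> \<real>" for j by simp
    show "total \<alpha> \<le> d" if "(\<alpha>, \<beta>) \<in> Poly_Mapping.keys a" for \<alpha> \<beta> by (rule ls(2)[OF that])
  qed (rule ls(3))
  then show thesis by (rule that)
qed

text \<open>The zero operator satisfies \<open>pres\<close> trivially. If its coefficient family
  were nonzero, it would form a \<open>preserver\<close>, whose values on \<open>approx\<close> are
  eventually nonzero at a point of the ray.\<close>

lemma weyl_op_eq_0_imp:
  assumes "weyl_op a = (\<lambda>_. 0)"
  shows "a = 0"
proof (rule ccontr)
  assume "a \<noteq> 0"
  then obtain l s d where "preserver a l s d"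
    by (rule preserver_exists) (simp add: assms)
  then interpret preserver a l s d .
  obtain y where y: "\<forall>\<^sub>F N in sequentially. meval (ray y) (weyl_op a (approx (\<lambda>_. 1) N)) \<noteq> 0"
    by (rule weyl_op_approx_nonzero[of "\<lambda>_. 1"]) simp
  show False using y unfolding assms by simp
qed

theorem theorem1p3:
  fixes T :: "('n::finite, complex) mpoly \<Rightarrow> ('n, complex) mpoly"
    and a :: "('n \<Rightarrow>\<^sub>0 nat) \<times> ('n \<Rightarrow>\<^sub>0 nat) \<Rightarrow>\<^sub>0 real"
  assumes "T = weyl_op a"
  shows "T \<in> real_stability_preserving \<longleftrightarrow> negate_w (weyl_symbol a) \<in> real_stable"
proof
  assume "T \<in> real_stability_preserving"
  then have pres: "\<And>f. f \<in> real_stable \<Longrightarrow> weyl_op a f \<in> real_stable \<union> {0}"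
    and T: "weyl_op a \<noteq> (\<lambda>_. 0)"
    using assms unfolding real_stability_preserving_def by blast+
  have "a \<noteq> 0"
  proof
    assume "a = 0"
    then have "weyl_op a = (\<lambda>_. 0)" by (simp add: weyl_op_def fun_eq_iff)
    with T show False by contradiction
  qed
  then obtain l s d where "preserver a l s d"
    using pres by (rule preserver_exists)
  then have nz: "symb a z (\<lambda>j. - w j) \<noteq> 0" if "z \<in> upper" "w \<in> upper" for z w
    using that by (rule symb_nonzero_if_preserver)
  have "meval x (negate_w (weyl_symbol a)) \<noteq> 0" if "x \<in> upper" for x
    unfolding meval_negate_symbol by (rule nz) (use that in \<open>simp_all add: upper_def\<close>)
  then show "negate_w (weyl_symbol a) \<in> real_stable"
    unfolding real_stable_iff using real_coeffs_negate_symbol by blast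
next
  assume stable: "negate_w (weyl_symbol a) \<in> real_stable"
  have nz: "symb a z (\<lambda>j. - w j) \<noteq> 0" if zw: "z \<in> upper" "w \<in> upper" for z w
  proof -
    have "Im (case_sum z w v) > 0" for v
      using zw by (cases v) (simp_all add: upper_def)
    then have "meval (case_sum z w) (negate_w (weyl_symbol a)) \<noteq> 0"
      using stable by (simp add: real_stable_iff upper_def)
    then show ?thesis by (simp add: meval_negate_symbol)
  qed
  have "weyl_op a f \<in> real_stable \<union> {0}" if "f \<in> real_stable" for f
  proof (cases "\<forall>z\<in>upper. meval z (weyl_op a f) \<noteq> 0")
    case True
    then show ?thesis using that real_coeffs_weyl_op[of f a] by (simp add: real_stable_iff)
  next
    case False
    then obtain z0 where z0: "z0 \<in> upper" "meval z0 (weyl_op a f) = 0" by blast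
    have "weyl_op a f = 0"
      by (rule weyl_op_stable_or_0[OF _ _ z0]) (use nz that in \<open>simp_all add: real_stable_iff\<close>)
    then show ?thesis by simp
  qed
  moreover have "weyl_op a \<noteq> (\<lambda>_. 0)"
  proof
    assume "weyl_op a = (\<lambda>_. 0)"
    then have "a = 0" by (rule weyl_op_eq_0_imp)
    \<comment> \<open>For \<open>a = 0\<close> the symbol vanishes everywhere, contrary to its
      stability.\<close>
    then show False using nz[of "\<lambda>_. \<i>" "\<lambda>_. \<i>"] by (simp add: symb_def upper_def)
  qed
  ultimately show "T \<in> real_stability_preserving"
    unfolding real_stability_preserving_def real_weyl_algebra_def assms by blast
qed

end
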